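(* Let $N,M\ge 1$ be integers and let $\mathcal{O}=\mathbb{G}_{2N}\times\mathbb{G}_{2M}$. For each $\lambda=(\lambda_1,\lambda_2,\lambda_3)\in\Bbbk^3$ there is a decomposition $\mathcal{O}=\mathcal{O}_1\sqcup\mathcal{O}_2\sqcup\mathcal{O}_4$ (given by the subsets described in the context) so that, up to isomorphism, the simple modules of $H_\lambda$ are: $|\mathcal{O}_1|$ modules $L_1^\chi$ of dimension 1, $\tfrac12|\mathcal{O}_2|$ modules $L_{2,h}^\chi$ or $L_{2,v}^\chi$ of dimension 2, and $\tfrac12|\mathcal{O}_4|$ modules $L_4^\chi(d)$ of dimension 4. These modules are of the following form, for scalars $\alpha_1,\alpha_2,\alpha_3,d,c\in\Bbbk$ depending on $(\lambda,\chi)$ as in the context (in each case the listed basis vectors lie in the indicated $\Gamma$-isotypic components): (1) $L_1^\chi=\Bbbk v$, $v$ of type $\chi$, $a_1v=a_2v=0$; (2h) $L_{2,h}^\chi$ has basis $v,w$ of types $\chi,\bar\chi$ with $a_1v=w$, $a_1w=\alpha_1v$, $a_2v=a_2w=0$; (2v) $L_{2,v}^\chi$ has basis $v,w$ of types $\chi,-\chi$ with $a_2v=w$, $a_2w=\alpha_2v$, $a_1v=a_1w=0$; (4) $L_4^\chi(d)$ has basis $v_1,v_2,v_3,v_4$ of types $\chi,\bar\chi,-\bar\chi,-\chi$ with $a_1v_1=v_2$, $a_1v_2=\alpha_1v_1$, $a_1v_3=v_4$, $a_1v_4=\alpha_1v_3$, $a_2v_1=d\,v_4$, $a_2v_4=c\,v_1$,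 $a_2v_2=v_3$, $a_2v_3=\alpha_2v_2$.
   Context: $\Bbbk$ is an algebraically closed field of characteristic zero; $\mathbb{G}_n\subset\Bbbk$ is the group of $n$th roots of 1. $\Gamma=\langle g_1,g_2: g_1g_2=g_2g_1,\ g_1^{2N}=g_2^{2M}=1\rangle$. For $\lambda=(\lambda_1,\lambda_2,\lambda_3)\in\Bbbk^3$, $H_\lambda$ is the algebra generated by $\Gamma$ and $a_1,a_2$ with relations $g_1a_1=-a_1g_1$, $g_1a_2=-a_2g_1$, $g_2a_1=a_1g_2$, $g_2a_2=-a_2g_2$, $a_1^2=\lambda_1(1-g_1^2)$, $a_2^2=\lambda_2(1-g_2^2)$, $a_1a_2a_1a_2+a_2a_1a_2a_1=\lambda_3(1-g_1^2g_2^2)-2\lambda_1\lambda_2(1+g_2^2)(1-g_1^2)$. For $\chi=(\chi_1,\chi_2)\in\mathcal{O}$, a vector $v$ of a module is of type $\chi$ if $g_iv=\chi_iv$, $i=1,2$. Put $\bar\chi=(-\chi_1,\chi_2)$, $-\chi=(-\chi_1,-\chi_2)$, $-\bar\chi=(\chi_1,-\chi_2)$, and $\alpha_1=\lambda_1(1-\chi_1^2)$, $\alpha_2=\lambda_2(1-\chi_2^2)$, $\alpha_3=\lambda_3(1-\chi_1^2\chi_2^2)-2\lambda_1\lambda_2(1+\chi_2^2)(1-\chi_1^2)$. $\mathcal{O}_1=\{\chi:\alpha_1=\alpha_2=\alpha_3=0\}$; $\mathcal{O}_2=\{\chi:\alpha_3=0$ and exactly one of $\alpha_1,\alpha_2$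 is nonzero$\}$; $\mathcal{O}_4=\mathcal{O}\setminus(\mathcal{O}_1\sqcup\mathcal{O}_2)$. The module $L_1^\chi$ is considered for $\chi\in\mathcal{O}_1$; $L_{2,h}^\chi$ for $\chi\in\mathcal{O}_2$ with $\alpha_1\neq0$; $L_{2,v}^\chi$ for $\chi\in\mathcal{O}_2$ with $\alpha_2\neq 0$; $L_4^\chi(d)$ for $\chi\in\mathcal{O}_4$ and $d\in\Bbbk$ with $\alpha_1^2\alpha_2d^2-\alpha_3d+\alpha_2=0$, with $c=\alpha_3-\alpha_1^2\alpha_2d$.
   Formalization: The number ½|O₄| of modules L₄^χ(d) is proved with d counted by its multiplicity as a root of α₁²α₂X²−α₃X+α₂; the literal count is proved when no χ in O₄ with α₁,α₂≠0 has α₃²=4α₁²α₂², since otherwise it is false. *)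

theory Defs
  imports
    "HOL-Algebra.QuotRing"
    "HOL-Algebra.Module"
    "HOL-Library.Poly_Mapping"
    "HOL-Computational_Algebra.Polynomial"
begin

section \<open>Left modules over a ring that need not be commutative\<close>

text \<open>The locale \<^locale>\<open>module\<close> of HOL-Algebra requires a commutative ring, so its axioms are
  repeated here over \<^locale>\<open>ring\<close>. The locale \<^locale>\<open>submodule\<close> has no such restriction.\<close>

locale left_module = R?: ring R + M?: abelian_group M for R (structure) and M (structure) +
  assumes smult_closed:
      "\<lbrakk>a \<in> carrier R; x \<in> carrier M\<rbrakk> \<Longrightarrow> a \<odot>\<^bsub>M\<^esub> x \<in> carrier M"
    and smult_l_distr:
      "\<lbrakk>a \<in> carrier R; b \<in> carrier R; x \<in> carrier M\<rbrakk> \<Longrightarrow>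
        (a \<oplus>\<^bsub>R\<^esub> b) \<odot>\<^bsub>M\<^esub> x = a \<odot>\<^bsub>M\<^esub> x \<oplus>\<^bsub>M\<^esub> b \<odot>\<^bsub>M\<^esub> x"
    and smult_r_distr:
      "\<lbrakk>a \<in> carrier R; x \<in> carrier M; y \<in> carrier M\<rbrakk> \<Longrightarrow>
        a \<odot>\<^bsub>M\<^esub> (x \<oplus>\<^bsub>M\<^esub> y) = a \<odot>\<^bsub>M\<^esub> x \<oplus>\<^bsub>M\<^esub> a \<odot>\<^bsub>M\<^esub> y"
    and smult_assoc:
      "\<lbrakk>a \<in> carrier R; b \<in> carrier R; x \<in> carrier M\<rbrakk> \<Longrightarrow>
        (a \<otimes>\<^bsub>R\<^esub> b) \<odot>\<^bsub>M\<^esub> x = a \<odot>\<^bsub>M\<^esub> (b \<odot>\<^bsub>M\<^esub> x)"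
    and smult_one:
      "x \<in> carrier M \<Longrightarrow> \<one>\<^bsub>R\<^esub> \<odot>\<^bsub>M\<^esub> x = x"

definition simple_module :: "('r, 's) ring_scheme \<Rightarrow> ('r, 'v) module \<Rightarrow> bool" where
  "simple_module R V \<longleftrightarrow> left_module R V \<and> carrier V \<noteq> {\<zero>\<^bsub>V\<^esub>} \<and>
     (\<forall>W. submodule W R V \<longrightarrow> W = {\<zero>\<^bsub>V\<^esub>} \<or> W = carrier V)"

definition module_iso ::
    "('r, 's) ring_scheme \<Rightarrow> ('r, 'v) module \<Rightarrow> ('r, 'w) module \<Rightarrow> bool" where
  "module_iso R V W \<longleftrightarrow> (\<exists>f. bij_betw f (carrier V) (carrier W) \<and>
     (\<forall>x\<in>carrier V. \<forall>y\<in>carrier V. f (x \<oplus>\<^bsub>V\<^esub> y) = f x \<oplus>\<^bsub>W\<^esub> f y) \<and>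
     (\<forall>a\<in>carrier R. \<forall>x\<in>carrier V. f (a \<odot>\<^bsub>V\<^esub> x) = a \<odot>\<^bsub>W\<^esub> f x))"

section \<open>The algebra \<open>H\<^sub>\<lambda>\<close>\<close>

text \<open>Free associative algebra on four letters: finitely supported functions on the free monoid.
  The free monoid is written additively, because \<open>Poly_Mapping\<close> takes the convolution product with
  respect to \<open>+\<close> on the exponents.\<close>

datatype letter = Lg1 | Lg2 | La1 | La2

datatype word = Word "letter list"

instantiation word :: monoid_add
begin
definition zero_word :: word where "0 = Word []"
fun plus_word :: "word \<Rightarrow> word \<Rightarrow> word" where "Word u + Word v = Word (u @ v)"
instance
proof
  fix a b c :: word
  show "a + b + c = a + (b + c)" by (cases a; cases b; cases c) simp
  show "0 + a = a" by (cases a) (simp add: zero_word_def)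
  show "a + 0 = a" by (cases a) (simp add: zero_word_def)
qed
end

type_synonym 'k free_alg = "word \<Rightarrow>\<^sub>0 'k"

definition const :: "'k \<Rightarrow> 'k::field free_alg" where
  "const c = Poly_Mapping.single 0 c"

definition gen :: "letter \<Rightarrow> 'k::field free_alg" where
  "gen x = Poly_Mapping.single (Word [x]) 1"

definition free_alg_ring :: "'k::field free_alg ring" where
  "free_alg_ring = \<lparr>carrier = UNIV, monoid.mult = (*), one = 1, zero = 0, add = (+)\<rparr>"

text \<open>The generators \<open>g\<^sub>1, g\<^sub>2\<close> are invertible in the quotient by the second and third relation, so the
  group \<open>\<Gamma>\<close> needs no further generators. Each relation \<open>p = q\<close> is given as \<open>p - q\<close>.\<close>

fun H_relations :: "nat \<Rightarrow> nat \<Rightarrow> 'k \<times> 'k \<times> 'k \<Rightarrow> 'k::field free_alg set" where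
  "H_relations N M (l1, l2, l3) =
    (let g1 = gen Lg1; g2 = gen Lg2; a1 = gen La1; a2 = gen La2 in
     { g1 * g2 - g2 * g1,
       g1 ^ (2 * N) - 1,
       g2 ^ (2 * M) - 1,
       g1 * a1 - (- a1 * g1),
       g1 * a2 - (- a2 * g1),
       g2 * a1 - a1 * g2,
       g2 * a2 - (- a2 * g2),
       a1 ^ 2 - const l1 * (1 - g1 ^ 2),
       a2 ^ 2 - const l2 * (1 - g2 ^ 2),
       (a1 * a2 * a1 * a2 + a2 * a1 * a2 * a1)
         - (const l3 * (1 - g1 ^ 2 * g2 ^ 2)
            - const (2 * l1 * l2) * (1 + g2 ^ 2) * (1 - g1 ^ 2)) })"

definition H_ideal :: "nat \<Rightarrow> nat \<Rightarrow> 'k \<times> 'k \<times> 'k \<Rightarrow> 'k::field free_alg set" where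
  "H_ideal N M l = Idl\<^bsub>free_alg_ring\<^esub> (H_relations N M l)"

definition H_alg :: "nat \<Rightarrow> nat \<Rightarrow> 'k \<times> 'k \<times> 'k \<Rightarrow> 'k::field free_alg set ring" where
  "H_alg N M l = free_alg_ring Quot (H_ideal N M l)"

text \<open>The class in \<open>H\<^sub>\<lambda>\<close> of an element of the free algebra, and its action on a module. The scalars
  \<open>c\<close> of the ground field act through the classes of \<open>const c\<close>.\<close>

definition H_class :: "nat \<Rightarrow> nat \<Rightarrow> 'k \<times> 'k \<times> 'k \<Rightarrow> 'k::field free_alg \<Rightarrow> 'k free_alg set" where
  "H_class N M l p = H_ideal N M l +>\<^bsub>free_alg_ring\<^esub> p"

type_synonym ('k, 'v) H_mod = "('k free_alg set, 'v) module"

definition act ::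
    "nat \<Rightarrow> nat \<Rightarrow> 'k \<times> 'k \<times> 'k \<Rightarrow> ('k::field, 'v) H_mod \<Rightarrow> 'k free_alg \<Rightarrow> 'v \<Rightarrow> 'v" where
  "act N M l V p v = H_class N M l p \<odot>\<^bsub>V\<^esub> v"

definition is_basis ::
    "nat \<Rightarrow> nat \<Rightarrow> 'k \<times> 'k \<times> 'k \<Rightarrow> ('k::field, 'v) H_mod \<Rightarrow> 'v list \<Rightarrow> bool" where
  "is_basis N M l V vs \<longleftrightarrow> set vs \<subseteq> carrier V \<and>
     (\<forall>x\<in>carrier V. \<exists>!cs. length cs = length vs \<and>
        x = (\<Oplus>\<^bsub>V\<^esub>i\<in>{..<length vs}. act N M l V (const (cs ! i)) (vs ! i)))"

section \<open>Characters and scalars\<close>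

definition roots_of_1 :: "nat \<Rightarrow> 'k::field set" where
  "roots_of_1 n = {x. x ^ n = 1}"

definition chars :: "nat \<Rightarrow> nat \<Rightarrow> ('k::field \<times> 'k) set" where
  "chars N M = roots_of_1 (2 * N) \<times> roots_of_1 (2 * M)"

fun alpha1 :: "'k \<times> 'k \<times> 'k \<Rightarrow> 'k \<times> 'k \<Rightarrow> 'k::field" where
  "alpha1 (l1, l2, l3) (x1, x2) = l1 * (1 - x1 ^ 2)"

fun alpha2 :: "'k \<times> 'k \<times> 'k \<Rightarrow> 'k \<times> 'k \<Rightarrow> 'k::field" where
  "alpha2 (l1, l2, l3) (x1, x2) = l2 * (1 - x2 ^ 2)"

fun alpha3 :: "'k \<times> 'k \<times> 'k \<Rightarrow> 'k \<times> 'k \<Rightarrow> 'k::field" where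
  "alpha3 (l1, l2, l3) (x1, x2) =
     l3 * (1 - x1 ^ 2 * x2 ^ 2) - 2 * l1 * l2 * (1 + x2 ^ 2) * (1 - x1 ^ 2)"

definition O1 :: "nat \<Rightarrow> nat \<Rightarrow> 'k \<times> 'k \<times> 'k \<Rightarrow> ('k::field \<times> 'k) set" where
  "O1 N M l = {\<chi> \<in> chars N M. alpha1 l \<chi> = 0 \<and> alpha2 l \<chi> = 0 \<and> alpha3 l \<chi> = 0}"

definition O2 :: "nat \<Rightarrow> nat \<Rightarrow> 'k \<times> 'k \<times> 'k \<Rightarrow> ('k::field \<times> 'k) set" where
  "O2 N M l = {\<chi> \<in> chars N M. alpha3 l \<chi> = 0 \<and> (alpha1 l \<chi> \<noteq> 0) \<noteq> (alpha2 l \<chi> \<noteq> 0)}"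

definition O4 :: "nat \<Rightarrow> nat \<Rightarrow> 'k \<times> 'k \<times> 'k \<Rightarrow> ('k::field \<times> 'k) set" where
  "O4 N M l = chars N M - (O1 N M l \<union> O2 N M l)"

text \<open>The polynomial \<open>\<alpha>\<^sub>1\<^sup>2 \<alpha>\<^sub>2 X\<^sup>2 - \<alpha>\<^sub>3 X + \<alpha>\<^sub>2\<close>, whose roots are the admissible parameters \<open>d\<close>.
  If \<open>\<alpha>\<^sub>1, \<alpha>\<^sub>2 \<noteq> 0\<close> and \<open>\<alpha>\<^sub>3\<^sup>2 = 4 \<alpha>\<^sub>1\<^sup>2 \<alpha>\<^sub>2\<^sup>2\<close>, then \<open>d\<close> is a double root and the four characters
  \<open>(\<plusminus>\<chi>\<^sub>1, \<plusminus>\<chi>\<^sub>2)\<close> together give one simple module instead of two. For this reason the modules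
  \<open>L\<^sub>4\<^sup>\<chi>(d)\<close> have to be counted with the multiplicity of \<open>d\<close> as a root.\<close>

definition d_poly :: "'k \<times> 'k \<times> 'k \<Rightarrow> 'k \<times> 'k \<Rightarrow> 'k::field poly" where
  "d_poly l \<chi> = [: alpha2 l \<chi>, - alpha3 l \<chi>, (alpha1 l \<chi>) ^ 2 * alpha2 l \<chi> :]"

definition c_of :: "'k \<times> 'k \<times> 'k \<Rightarrow> 'k \<times> 'k \<Rightarrow> 'k \<Rightarrow> 'k::field" where
  "c_of l \<chi> d = alpha3 l \<chi> - (alpha1 l \<chi>) ^ 2 * alpha2 l \<chi> * d"

fun bar_char :: "'k \<times> 'k \<Rightarrow> 'k \<times> 'k::field" where
  "bar_char (x1, x2) = (- x1, x2)"

fun neg_char :: "'k \<times> 'k \<Rightarrow> 'k \<times> 'k::field" where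
  "neg_char (x1, x2) = (- x1, - x2)"

section \<open>The modules of the list\<close>

definition of_type ::
    "nat \<Rightarrow> nat \<Rightarrow> 'k \<times> 'k \<times> 'k \<Rightarrow> ('k::field, 'v) H_mod \<Rightarrow> 'k \<times> 'k \<Rightarrow> 'v \<Rightarrow> bool" where
  "of_type N M l V \<chi> v \<longleftrightarrow> v \<in> carrier V \<and>
     act N M l V (gen Lg1) v = act N M l V (const (fst \<chi>)) v \<and>
     act N M l V (gen Lg2) v = act N M l V (const (snd \<chi>)) v"

text \<open>Indices of the modules \<open>L\<^sub>1\<^sup>\<chi>\<close>, \<open>L\<^sub>2\<^sub>,\<^sub>h\<^sup>\<chi>\<close>, \<open>L\<^sub>2\<^sub>,\<^sub>v\<^sup>\<chi>\<close> and \<open>L\<^sub>4\<^sup>\<chi>(d)\<close>.\<close>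

datatype 'k label = L1 "'k \<times> 'k" | L2h "'k \<times> 'k" | L2v "'k \<times> 'k" | L4 "'k \<times> 'k" 'k

definition labels :: "nat \<Rightarrow> nat \<Rightarrow> 'k \<times> 'k \<times> 'k \<Rightarrow> 'k::field label set" where
  "labels N M l =
     {L1 \<chi> | \<chi>. \<chi> \<in> O1 N M l} \<union>
     {L2h \<chi> | \<chi>. \<chi> \<in> O2 N M l \<and> alpha1 l \<chi> \<noteq> 0} \<union>
     {L2v \<chi> | \<chi>. \<chi> \<in> O2 N M l \<and> alpha2 l \<chi> \<noteq> 0} \<union>
     {L4 \<chi> d | \<chi> d. \<chi> \<in> O4 N M l \<and>
        (alpha1 l \<chi>) ^ 2 * alpha2 l \<chi> * d ^ 2 - alpha3 l \<chi> * d + alpha2 l \<chi> = 0}"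

text \<open>\<open>has_form N M l x V\<close>: the \<open>H\<^sub>\<lambda>\<close>-module \<open>V\<close> has a basis, with the given types, on which
  \<open>a\<^sub>1, a\<^sub>2\<close> act by the formulas for the module with index \<open>x\<close>.\<close>

fun has_form ::
    "nat \<Rightarrow> nat \<Rightarrow> 'k \<times> 'k \<times> 'k \<Rightarrow> 'k label \<Rightarrow> ('k::field, 'v) H_mod \<Rightarrow> bool" where
  "has_form N M l (L1 \<chi>) V \<longleftrightarrow> left_module (H_alg N M l) V \<and>
     (\<exists>v. is_basis N M l V [v] \<and> of_type N M l V \<chi> v \<and>
        act N M l V (gen La1) v = \<zero>\<^bsub>V\<^esub> \<and> act N M l V (gen La2) v = \<zero>\<^bsub>V\<^esub>)"
| "has_form N M l (L2h \<chi>) V \<longleftrightarrow> left_module (H_alg N M l) V \<and>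
     (\<exists>v w. is_basis N M l V [v, w] \<and>
        of_type N M l V \<chi> v \<and> of_type N M l V (bar_char \<chi>) w \<and>
        act N M l V (gen La1) v = w \<and>
        act N M l V (gen La1) w = act N M l V (const (alpha1 l \<chi>)) v \<and>
        act N M l V (gen La2) v = \<zero>\<^bsub>V\<^esub> \<and> act N M l V (gen La2) w = \<zero>\<^bsub>V\<^esub>)"
| "has_form N M l (L2v \<chi>) V \<longleftrightarrow> left_module (H_alg N M l) V \<and>
     (\<exists>v w. is_basis N M l V [v, w] \<and>
        of_type N M l V \<chi> v \<and> of_type N M l V (neg_char \<chi>) w \<and>
        act N M l V (gen La2) v = w \<and>
        act N M l V (gen La2) w = act N M l V (const (alpha2 l \<chi>)) v \<and>
        act N M l V (gen La1) v = \<zero>\<^bsub>V\<^esub> \<and> act N M l V (gen La1) w = \<zero>\<^bsub>V\<^esub>)"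
| "has_form N M l (L4 \<chi> d) V \<longleftrightarrow> left_module (H_alg N M l) V \<and>
     (\<exists>v1 v2 v3 v4. is_basis N M l V [v1, v2, v3, v4] \<and>
        of_type N M l V \<chi> v1 \<and> of_type N M l V (bar_char \<chi>) v2 \<and>
        of_type N M l V (neg_char (bar_char \<chi>)) v3 \<and> of_type N M l V (neg_char \<chi>) v4 \<and>
        act N M l V (gen La1) v1 = v2 \<and>
        act N M l V (gen La1) v2 = act N M l V (const (alpha1 l \<chi>)) v1 \<and>
        act N M l V (gen La1) v3 = v4 \<and>
        act N M l V (gen La1) v4 = act N M l V (const (alpha1 l \<chi>)) v3 \<and>
        act N M l V (gen La2) v1 = act N M l V (const d) v4 \<and>
        act N M l V (gen La2) v4 = act N M l V (const (c_of l \<chi> d)) v1 \<and>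
        act N M l V (gen La2) v2 = v3 \<and>
        act N M l V (gen La2) v3 = act N M l V (const (alpha2 l \<chi>)) v2)"

end

(*
  Idea. On the vectors of type \<chi> and of its sign changes, a_1^2, a_2^2 and a_1 a_2 a_1 a_2 + a_2 a_1 a_2 a_1
  act by the scalars \<alpha>_1, \<alpha>_2, \<alpha>_3, while a_1 changes the type \<chi> to bar \<chi> and a_2 changes it to -\<chi>.
  Since g_1 and g_2 have finite order, every simple module S has a vector v of some type \<chi>. The operator
  T = a_2 a_1 a_2 a_1 preserves the type and satisfies T^2 - \<alpha>_3 T + \<alpha>_1^2 \<alpha>_2^2 = 0.
  If \<chi> is in O_4, v can be replaced by an eigenvector of T with eigenvalue t \<noteq> 0; then
  a_2 v = (\<alpha>_2 / t) a_1 a_2 a_1 v, which gives a nonzero map L_4(\<alpha>_2 / t) --> S. In the other cases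
  nilpotency gives a vector killed by enough of a_1, a_2, hence a nonzero map L_1 --> S or L_2 --> S. By Schur's
  lemma these maps are isomorphisms. The modules of the list are told apart by the pairs (type, eigenvalue of T),
  and a choice of one element in each pair {x, -x} selects one label per isomorphism class.
*)

theory Submission
  imports Defs
begin

section \<open>The quotient of the free algebra\<close>

text \<open>A simple module \<open>S\<close> has an arbitrary carrier type and is not assumed
  finite-dimensional. Eigenvectors are therefore extracted from explicit annihilating polynomials
  (\<open>X^(2*N) - 1\<close>, \<open>X^(2*M) - 1\<close> and the quadratic of T), and isomorphisms
  come from nonzero maps out of concrete modules.

  The scalars \<alpha>_i depend only on squares, so they are constant on the four sign changes of
  \<chi>, which are distinct because roots of unity are nonzero and 2 is invertible. An orbit in O_4
  contributes 2 to the count with multiplicity for two different reasons. If \<alpha>_1 \<alpha>_2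
  \<noteq> 0, every module involves all four types with nonzero eigenvalues of T, so \<chi> can be
  fixed in the orbit and the two roots d, counted with multiplicity, give the modules. If \<alpha>_1
  \<alpha>_2 = 0, the equation for d is linear, but T has eigenvalue \<alpha>_3 on the types \<chi>,
  -bar \<chi> of L_4 and 0 on the other two, so the orbit splits into two halves with one module
  each. Hence the choice of representatives and the count distinguish these cases.\<close>

lemma free_alg_ring_simps [simp]:
  "carrier free_alg_ring = UNIV" "monoid.mult free_alg_ring = (*)" "one free_alg_ring = 1"
  "zero free_alg_ring = 0" "add free_alg_ring = (+)"
  by (simp_all add: free_alg_ring_def)

lemma ring_free_alg: "ring (free_alg_ring :: 'k::field free_alg ring)"
proof (rule ringI)
  show "abelian_group (free_alg_ring :: 'k free_alg ring)"
    by (rule abelian_groupI) (auto simp: algebra_simps intro: exI[of _ "- x" for x])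
  show "monoid (free_alg_ring :: 'k free_alg ring)"
    by (rule monoidI) (auto simp: algebra_simps)
qed (auto simp: algebra_simps)

lemma a_inv_free_alg [simp]: "\<ominus>\<^bsub>free_alg_ring\<^esub> p = - (p :: 'k::field free_alg)"
proof -
  interpret ring "free_alg_ring :: 'k free_alg ring" by (rule ring_free_alg)
  show ?thesis by (rule minus_equality) auto
qed

lemma ideal_H: "ideal (H_ideal N M l) (free_alg_ring :: 'k::field free_alg ring)"
  unfolding H_ideal_def by (rule ring.genideal_ideal[OF ring_free_alg]) simp

lemma H_relation_in_ideal: "r \<in> H_relations N M l \<Longrightarrow> r \<in> H_ideal N M l"
  unfolding H_ideal_def using ring.genideal_self[OF ring_free_alg, of "H_relations N M l"] by auto

text \<open>The elements satisfying \<open>P\<close> form a two-sided ideal containing the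
  relations, so minimality of the generated ideal applies. Negation is covered by multiplication by
  -1.\<close>

lemma H_ideal_induct [consumes 1, case_names relation zero add mult_left mult_right]:
  fixes P :: "'k::field free_alg \<Rightarrow> bool"
  assumes "p \<in> H_ideal N M l"
    and "\<And>r. r \<in> H_relations N M l \<Longrightarrow> P r"
    and "P 0" "\<And>p q. P p \<Longrightarrow> P q \<Longrightarrow> P (p + q)"
    and "\<And>p q. P p \<Longrightarrow> P (q * p)" "\<And>p q. P p \<Longrightarrow> P (p * q)"
  shows "P p"
proof -
  have neg: "P (- p)" if "P p" for p using assms(5)[OF that, of "-1"] by simp
  interpret ring "free_alg_ring :: 'k free_alg ring" by (rule ring_free_alg)
  have "subgroup {p. P p} (add_monoid (free_alg_ring :: 'k free_alg ring))"
    by (rule add.subgroupI) (auto simp: assms neg a_inv_def[symmetric] intro: exI[of _ 0])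
  then have "ideal {p. P p} (free_alg_ring :: 'k free_alg ring)"
    by (rule idealI[OF ring_free_alg]) (auto simp: assms)
  then have "H_ideal N M l \<subseteq> {p. P p}"
    unfolding H_ideal_def by (rule genideal_minimal) (use assms(2) in auto)
  then show ?thesis using assms(1) by auto
qed

lemma ring_H_alg: "ring (H_alg N M l)"
  unfolding H_alg_def by (rule ideal.quotient_is_ring[OF ideal_H])

lemma H_class_hom:
  "H_class N M l p \<in> carrier (H_alg N M l)"
  "H_class N M l (p + q) = H_class N M l p \<oplus>\<^bsub>H_alg N M l\<^esub> H_class N M l q"
  "H_class N M l (p * q) = H_class N M l p \<otimes>\<^bsub>H_alg N M l\<^esub> H_class N M l q"
  "H_class N M l 1 = \<one>\<^bsub>H_alg N M l\<^esub>"
  using ideal.rcos_ring_hom[OF ideal_H[of N M l]]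
  unfolding H_class_def H_alg_def ring_hom_def by auto

lemma H_class_cases:
  assumes "X \<in> carrier (H_alg N M l)"
  obtains p where "X = H_class N M l p"
  using assms unfolding H_alg_def H_class_def FactRing_def A_RCOSETS_def' by auto

lemma H_class_eq_iff: "H_class N M l p = H_class N M l q \<longleftrightarrow> p - q \<in> H_ideal N M l"
proof -
  interpret ideal "H_ideal N M l" free_alg_ring by (rule ideal_H)
  have "H_class N M l p = H_class N M l q \<longleftrightarrow> p \<ominus>\<^bsub>free_alg_ring\<^esub> q \<in> H_ideal N M l"
    unfolding H_class_def using quotient_eq_iff_same_a_r_cos[OF ideal_H, of p q] by simp
  then show ?thesis by (simp add: a_minus_def)
qed

lemma mem_H_class_self: "p \<in> H_class N M l p"
proof -
  interpret ideal "H_ideal N M l" free_alg_ring by (rule ideal_H)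
  show ?thesis unfolding H_class_def using a_rcos_self[of p] by simp
qed

lemma mem_H_class_iff: "q \<in> H_class N M l p \<longleftrightarrow> q - p \<in> H_ideal N M l"
proof -
  interpret ideal "H_ideal N M l" free_alg_ring by (rule ideal_H)
  show ?thesis unfolding H_class_def a_r_coset_def'
    by (auto simp: algebra_simps) (metis add.commute diff_add_cancel)
qed

section \<open>Induction on the free algebra\<close>

lemma gen_word: "Poly_Mapping.single (Word w) (c :: 'k::field) = const c * prod_list (map gen w)"
proof -
  have "prod_list (map gen w) = Poly_Mapping.single (Word w) (1::'k)"
    by (induction w) (auto simp: gen_def mult_single single_one[symmetric] zero_word_def simp del: single_one)
  then show ?thesis by (simp add: const_def mult_single)
qed

lemma poly_mapping_eq_sum_single:
  "p = (\<Sum>w\<in>Poly_Mapping.keys p. Poly_Mapping.single w (Poly_Mapping.lookup p w))"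
  by (rule poly_mapping_eqI) (auto simp: lookup_sum lookup_single when_def in_keys_iff)

text \<open>Every element is a finite sum of monomials, and \<open>gen_word\<close> writes a
  monomial as a constant times a product of letters.\<close>

lemma free_alg_induct [case_names const gen add mult]:
  fixes P :: "'k::field free_alg \<Rightarrow> bool"
  assumes "\<And>c. P (const c)" "\<And>x. P (gen x)"
    and "\<And>p q. P p \<Longrightarrow> P q \<Longrightarrow> P (p + q)" "\<And>p q. P p \<Longrightarrow> P q \<Longrightarrow> P (p * q)"
  shows "P p"
proof -
  have "const 0 = (0 :: 'k free_alg)" "const 1 = (1 :: 'k free_alg)" by (simp_all add: const_def)
  then have 0: "P 0" and 1: "P 1" using assms(1) by metis+
  have "P (prod_list (map gen w))" for w by (induction w) (auto simp: 1 assms)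
  then have "P (Poly_Mapping.single w c)" for w c by (cases w) (simp add: gen_word assms)
  then have "P (\<Sum>w\<in>A. Poly_Mapping.single w (f w))" for A f
    by (induction A rule: infinite_finite_induct) (auto simp: 0 assms)
  then show ?thesis using poly_mapping_eq_sum_single[of p] by metis
qed

lemma const_hom:
  "const (a + b) = const a + (const b :: 'k::field free_alg)"
  "const (a * b) = const a * (const b :: 'k free_alg)"
  "const (- a) = - (const a :: 'k free_alg)"
  "const 0 = (0 :: 'k free_alg)" "const 1 = (1 :: 'k free_alg)"
  by (simp_all add: const_def single_add mult_single single_uminus)

lemma const_commute: "const c * p = (p :: 'k::field free_alg) * const c"
proof (induction p rule: free_alg_induct)
  case (const d) show ?case by (simp add: const_def mult_single mult.commute)
next
  case (gen x) show ?case by (simp add: const_def gen_def mult_single)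
next
  case (mult p q) then show ?case by (metis mult.assoc)
qed (auto simp: algebra_simps)

section \<open>Operators on \<open>H\<^sub>\<lambda>\<close>-modules\<close>

lemma alpha_bar [simp]: "alpha1 l (bar_char \<chi>) = alpha1 l \<chi>" "alpha2 l (bar_char \<chi>) = alpha2 l \<chi>"
    "alpha3 l (bar_char \<chi>) = alpha3 l \<chi>"
  and alpha_neg [simp]: "alpha1 l (neg_char \<chi>) = alpha1 l \<chi>" "alpha2 l (neg_char \<chi>) = alpha2 l \<chi>"
    "alpha3 l (neg_char \<chi>) = alpha3 l \<chi>"
  by (cases l; cases \<chi>; simp)+

lemma char_bar_neg [simp]: "bar_char (bar_char \<chi>) = \<chi>" "neg_char (neg_char \<chi>) = \<chi>"
    "bar_char (neg_char \<chi>) = neg_char (bar_char \<chi>)"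
  by (cases \<chi>; simp)+

lemma fst_snd_bar_neg [simp]: "fst (bar_char \<chi>) = - fst \<chi>" "snd (bar_char \<chi>) = snd \<chi>"
    "fst (neg_char \<chi>) = - fst \<chi>" "snd (neg_char \<chi>) = - snd \<chi>"
  by (cases \<chi>; simp)+

lemma alpha_altdef:
  "alpha1 l \<chi> = fst l * (1 - fst \<chi> ^ 2)" "alpha2 l \<chi> = fst (snd l) * (1 - snd \<chi> ^ 2)"
  "alpha3 l \<chi> = snd (snd l) * (1 - fst \<chi> ^ 2 * snd \<chi> ^ 2)
     - 2 * fst l * fst (snd l) * (1 + snd \<chi> ^ 2) * (1 - fst \<chi> ^ 2)"
  by (cases l; cases \<chi>; simp)+

text \<open>As in \<open>alpha_altdef\<close>, projections replace the pattern of a triple, so that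
  the relations unfold for a variable \<open>l\<close>.\<close>

lemma H_relations_altdef:
  "H_relations N M l =
    (let g1 = gen Lg1; g2 = gen Lg2; a1 = gen La1; a2 = gen La2 in
     { g1 * g2 - g2 * g1, g1 ^ (2 * N) - 1, g2 ^ (2 * M) - 1,
       g1 * a1 - (- a1 * g1), g1 * a2 - (- a2 * g1), g2 * a1 - a1 * g2, g2 * a2 - (- a2 * g2),
       a1 ^ 2 - const (fst l) * (1 - g1 ^ 2), a2 ^ 2 - const (fst (snd l)) * (1 - g2 ^ 2),
       (a1 * a2 * a1 * a2 + a2 * a1 * a2 * a1)
         - (const (snd (snd l)) * (1 - g1 ^ 2 * g2 ^ 2)
            - const (2 * fst l * fst (snd l)) * (1 + g2 ^ 2) * (1 - g1 ^ 2)) })"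
  by (cases l) (simp add: Let_def)

locale H_module =
  fixes N M :: nat and l :: "'k::field \<times> 'k \<times> 'k" and V :: "('k, 'v) H_mod" (structure)
  assumes left_module_H: "left_module (H_alg N M l) V"

sublocale H_module \<subseteq> abelian_group V
  by (rule left_module.axioms(2)[OF left_module_H])

context H_module
begin

abbreviation app :: "'k free_alg \<Rightarrow> 'v \<Rightarrow> 'v"  (infixr "\<bullet>" 80)
  where "p \<bullet> v \<equiv> act N M l V p v"

abbreviation scale :: "'k \<Rightarrow> 'v \<Rightarrow> 'v"  (infixr "*\<^sub>V" 80)
  where "c *\<^sub>V v \<equiv> const c \<bullet> v"

abbreviation a1 :: "'v \<Rightarrow> 'v" where "a1 v \<equiv> gen La1 \<bullet> v"
abbreviation a2 :: "'v \<Rightarrow> 'v" where "a2 v \<equiv> gen La2 \<bullet> v"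
abbreviation "oftype \<equiv> of_type N M l V"

lemma app_closed [simp, intro]: "v \<in> carrier V \<Longrightarrow> p \<bullet> v \<in> carrier V"
  unfolding act_def by (rule left_module.smult_closed[OF left_module_H H_class_hom(1)])

lemma app_add: "v \<in> carrier V \<Longrightarrow> (p + q) \<bullet> v = p \<bullet> v \<oplus> q \<bullet> v"
  unfolding act_def H_class_hom
  by (rule left_module.smult_l_distr[OF left_module_H H_class_hom(1) H_class_hom(1)])

lemma app_mult: "v \<in> carrier V \<Longrightarrow> (p * q) \<bullet> v = p \<bullet> q \<bullet> v"
  unfolding act_def H_class_hom
  by (rule left_module.smult_assoc[OF left_module_H H_class_hom(1) H_class_hom(1)])

lemma app_one [simp]: "v \<in> carrier V \<Longrightarrow> 1 \<bullet> v = v"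
  unfolding act_def H_class_hom by (rule left_module.smult_one[OF left_module_H])

lemma app_add_right:
  "v \<in> carrier V \<Longrightarrow> w \<in> carrier V \<Longrightarrow> p \<bullet> (v \<oplus> w) = p \<bullet> v \<oplus> p \<bullet> w"
  unfolding act_def by (rule left_module.smult_r_distr[OF left_module_H H_class_hom(1)])

lemma app_zero [simp]: "v \<in> carrier V \<Longrightarrow> 0 \<bullet> v = \<zero>"
  using app_add[of v 0 0] by (metis add.l_cancel_one app_closed add_0)

lemma app_uminus: "v \<in> carrier V \<Longrightarrow> (- p) \<bullet> v = \<ominus> (p \<bullet> v)"
  using app_add[of v p "- p"] by (metis a_comm app_closed app_zero minus_equality right_minus)

lemma app_diff: "v \<in> carrier V \<Longrightarrow> (p - q) \<bullet> v = p \<bullet> v \<ominus> q \<bullet> v"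
  using app_add[of v p "- q"] by (simp add: app_uminus a_minus_def)

lemma app_zero_right [simp]: "p \<bullet> \<zero> = \<zero>"
  using app_add_right[of \<zero> \<zero> p] by (metis add.l_cancel_one app_closed zero_closed l_zero)

lemma app_finsum:
  "f \<in> A \<rightarrow> carrier V \<Longrightarrow> p \<bullet> (\<Oplus>i\<in>A. f i) = (\<Oplus>i\<in>A. p \<bullet> f i)"
  by (induction A rule: infinite_finite_induct) (auto simp: app_add_right Pi_def)

lemma app_power: "v \<in> carrier V \<Longrightarrow> (p ^ n) \<bullet> v = ((\<bullet>) p ^^ n) v"
  by (induction n) (auto simp: app_mult)

lemma app_commute:
  "v \<in> carrier V \<Longrightarrow> p * q = q * p \<Longrightarrow> p \<bullet> q \<bullet> v = q \<bullet> p \<bullet> v"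
  by (metis app_mult)

lemma app_scale [simp]: "v \<in> carrier V \<Longrightarrow> gen x \<bullet> c *\<^sub>V v = c *\<^sub>V gen x \<bullet> v"
  by (rule app_commute) (simp_all add: const_commute)

lemma scale_scale [simp]: "v \<in> carrier V \<Longrightarrow> c *\<^sub>V d *\<^sub>V v = (c * d) *\<^sub>V v"
  by (simp add: const_hom app_mult)

lemma scale_add: "v \<in> carrier V \<Longrightarrow> (c + d) *\<^sub>V v = c *\<^sub>V v \<oplus> d *\<^sub>V v"
  by (simp add: const_hom app_add)

lemma scale_one [simp]: "v \<in> carrier V \<Longrightarrow> 1 *\<^sub>V v = v"
  and scale_zero [simp]: "v \<in> carrier V \<Longrightarrow> 0 *\<^sub>V v = \<zero>"
  and scale_uminus: "v \<in> carrier V \<Longrightarrow> (- c) *\<^sub>V v = \<ominus> (c *\<^sub>V v)"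
  by (simp_all add: const_hom app_uminus)

lemma scale_eq_zero: "v \<in> carrier V \<Longrightarrow> c *\<^sub>V v = \<zero> \<Longrightarrow> c = 0 \<or> v = \<zero>"
  by (metis app_zero_right left_inverse scale_one scale_scale)

lemma scale_cancel: "v \<in> carrier V \<Longrightarrow> v \<noteq> \<zero> \<Longrightarrow> c *\<^sub>V v = d *\<^sub>V v \<Longrightarrow> c = d"
  using scale_add[of v d "c - d"] scale_eq_zero[of v "c - d"]
  by (auto simp: add.r_cancel_one)

lemma relation_eq:
  assumes "p - q \<in> H_relations N M l" "v \<in> carrier V"
  shows "p \<bullet> v = q \<bullet> v"
  using H_relation_in_ideal[OF assms(1)] unfolding act_def by (metis H_class_eq_iff)

lemma g1_a1: "v \<in> carrier V \<Longrightarrow> gen Lg1 \<bullet> a1 v = (-1) *\<^sub>V a1 (gen Lg1 \<bullet> v)"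
  and g1_a2: "v \<in> carrier V \<Longrightarrow> gen Lg1 \<bullet> a2 v = (-1) *\<^sub>V a2 (gen Lg1 \<bullet> v)"
  and g2_a1: "v \<in> carrier V \<Longrightarrow> gen Lg2 \<bullet> a1 v = a1 (gen Lg2 \<bullet> v)"
  and g2_a2: "v \<in> carrier V \<Longrightarrow> gen Lg2 \<bullet> a2 v = (-1) *\<^sub>V a2 (gen Lg2 \<bullet> v)"
  and g1_g2: "v \<in> carrier V \<Longrightarrow> gen Lg1 \<bullet> gen Lg2 \<bullet> v = gen Lg2 \<bullet> gen Lg1 \<bullet> v"
  using relation_eq[of "gen Lg1 * gen La1" "- gen La1 * gen Lg1" v]
    relation_eq[of "gen Lg1 * gen La2" "- gen La2 * gen Lg1" v]
    relation_eq[of "gen Lg2 * gen La1" "gen La1 * gen Lg2" v]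
    relation_eq[of "gen Lg2 * gen La2" "- gen La2 * gen Lg2" v]
    relation_eq[of "gen Lg1 * gen Lg2" "gen Lg2 * gen Lg1" v]
  by (simp_all add: H_relations_altdef Let_def app_mult app_uminus scale_uminus)

lemma of_type_closed: "oftype \<chi> v \<Longrightarrow> v \<in> carrier V"
  and of_type_g: "oftype \<chi> v \<Longrightarrow> gen Lg1 \<bullet> v = fst \<chi> *\<^sub>V v" "oftype \<chi> v \<Longrightarrow> gen Lg2 \<bullet> v = snd \<chi> *\<^sub>V v"
  by (simp_all add: of_type_def)

lemma of_type_a1: "oftype \<chi> v \<Longrightarrow> oftype (bar_char \<chi>) (a1 v)"
  and of_type_a2: "oftype \<chi> v \<Longrightarrow> oftype (neg_char \<chi>) (a2 v)"
  by (auto simp: of_type_def g1_a1 g2_a1 g1_a2 g2_a2)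

lemma of_type_scale: "oftype \<chi> v \<Longrightarrow> oftype \<chi> (c *\<^sub>V v)"
  by (auto simp: of_type_def mult.commute)

lemma of_type_add: "oftype \<chi> v \<Longrightarrow> oftype \<chi> w \<Longrightarrow> oftype \<chi> (v \<oplus> w)"
  by (auto simp: of_type_def app_add_right)

text \<open>Meant for \<open>p\<close> a group generator and \<open>v\<close> a vector of some type:
  the right-hand sides of the quadratic and quartic relations are built from these operators and
  thereby become scalars.\<close>

lemma one_minus_square:
  assumes "v \<in> carrier V" "p \<bullet> v = c *\<^sub>V v" "const c * p = p * const c"
  shows "(p ^ 2) \<bullet> v = (c\<^sup>2) *\<^sub>V v" "(1 - p ^ 2) \<bullet> v = (1 - c\<^sup>2) *\<^sub>V v"
    "(1 + p ^ 2) \<bullet> v = (1 + c\<^sup>2) *\<^sub>V v"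
proof -
  have "(p ^ 2) \<bullet> v = p \<bullet> c *\<^sub>V v"
    using assms by (simp only: power2_eq_square app_mult)
  also have "\<dots> = c *\<^sub>V p \<bullet> v" using assms by (intro app_commute) simp_all
  finally show *: "(p ^ 2) \<bullet> v = (c\<^sup>2) *\<^sub>V v"
    using assms by (simp only: scale_scale power2_eq_square)
  show "(1 - p ^ 2) \<bullet> v = (1 - c\<^sup>2) *\<^sub>V v"
    using scale_add[OF assms(1), of 1 "- (c\<^sup>2)"] scale_uminus[OF assms(1), of "c\<^sup>2"] assms(1)
    by (simp only: app_diff * a_minus_def app_one scale_one) simp
  show "(1 + p ^ 2) \<bullet> v = (1 + c\<^sup>2) *\<^sub>V v"
    using scale_add[OF assms(1), of 1 "c\<^sup>2"] assms(1) by (simp only: app_add * app_one scale_one)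
qed

lemma a1_a1:
  assumes "oftype \<chi> v" shows "a1 (a1 v) = alpha1 l \<chi> *\<^sub>V v"
proof -
  have v: "v \<in> carrier V" using assms by (rule of_type_closed)
  have "a1 (a1 v) = (gen La1 ^ 2) \<bullet> v" using v by (simp only: app_mult power2_eq_square)
  also have "\<dots> = (const (fst l) * (1 - gen Lg1 ^ 2)) \<bullet> v"
    by (rule relation_eq[OF _ v]) (simp add: H_relations_altdef Let_def)
  finally show ?thesis
    using one_minus_square(2)[OF v of_type_g(1)[OF assms] const_commute] v
    by (simp only: app_mult scale_scale alpha_altdef)
qed

lemma a2_a2:
  assumes "oftype \<chi> v" shows "a2 (a2 v) = alpha2 l \<chi> *\<^sub>V v"
proof -
  have v: "v \<in> carrier V" using assms by (rule of_type_closed)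
  have "a2 (a2 v) = (gen La2 ^ 2) \<bullet> v" using v by (simp only: app_mult power2_eq_square)
  also have "\<dots> = (const (fst (snd l)) * (1 - gen Lg2 ^ 2)) \<bullet> v"
    by (rule relation_eq[OF _ v]) (simp add: H_relations_altdef Let_def)
  finally show ?thesis
    using one_minus_square(2)[OF v of_type_g(2)[OF assms] const_commute] v
    by (simp only: app_mult scale_scale alpha_altdef)
qed

lemma a1212_a2121:
  assumes "oftype \<chi> v"
  shows "a1 (a2 (a1 (a2 v))) \<oplus> a2 (a1 (a2 (a1 v))) = alpha3 l \<chi> *\<^sub>V v"
proof -
  let ?x = "(fst \<chi>)\<^sup>2" and ?y = "(snd \<chi>)\<^sup>2"
  let ?g1 = "gen Lg1 ^ 2 :: 'k free_alg" and ?g2 = "gen Lg2 ^ 2 :: 'k free_alg"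
  define b where "b = 2 * fst l * fst (snd l)"
  have v: "v \<in> carrier V" using assms by (rule of_type_closed)
  note g1 = one_minus_square[OF v of_type_g(1)[OF assms] const_commute]
  note g2 = one_minus_square[OF v of_type_g(2)[OF assms] const_commute]
  have comm: "p \<bullet> c *\<^sub>V v = c *\<^sub>V p \<bullet> v" for p c
    by (rule app_commute[OF v const_commute[symmetric]])
  have g12: "(?g1 * ?g2) \<bullet> v = (?x * ?y) *\<^sub>V v"
    using v by (simp only: app_mult g1 g2 comm[of ?g1] scale_scale mult.commute[of ?y])
  have "(1 - ?g1 * ?g2) \<bullet> v = (1 - ?x * ?y) *\<^sub>V v"
    using scale_add[OF v, of 1 "- (?x * ?y)"] scale_uminus[OF v, of "?x * ?y"] v
    by (simp only: app_diff g12 a_minus_def app_one scale_one) simp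
  then have e1: "(const (snd (snd l)) * (1 - ?g1 * ?g2)) \<bullet> v = (snd (snd l) * (1 - ?x * ?y)) *\<^sub>V v"
    using v by (simp only: app_mult scale_scale)
  have e2: "(const b * (1 + ?g2) * (1 - ?g1)) \<bullet> v = (b * ((1 - ?x) * (1 + ?y))) *\<^sub>V v"
    using v by (simp only: app_mult g1 g2 comm[of "1 + ?g2"] scale_scale mult_ac)
  have "a1 (a2 (a1 (a2 v))) \<oplus> a2 (a1 (a2 (a1 v)))
      = (gen La1 * gen La2 * gen La1 * gen La2 + gen La2 * gen La1 * gen La2 * gen La1) \<bullet> v"
    using v by (simp only: app_mult app_add app_closed)
  also have "\<dots> = (const (snd (snd l)) * (1 - ?g1 * ?g2) - const b * (1 + ?g2) * (1 - ?g1)) \<bullet> v"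
    by (rule relation_eq[OF _ v]) (simp add: H_relations_altdef Let_def b_def)
  also have "\<dots> = (snd (snd l) * (1 - ?x * ?y)) *\<^sub>V v \<ominus> (b * ((1 - ?x) * (1 + ?y))) *\<^sub>V v"
    by (simp only: app_diff[OF v] e1 e2)
  also have "\<dots> = (snd (snd l) * (1 - ?x * ?y) + - (b * ((1 - ?x) * (1 + ?y)))) *\<^sub>V v"
    by (simp only: scale_add[OF v] scale_uminus[OF v] a_minus_def)
  also have "snd (snd l) * (1 - ?x * ?y) + - (b * ((1 - ?x) * (1 + ?y))) = alpha3 l \<chi>"
    by (simp add: alpha_altdef b_def mult_ac)
  finally show ?thesis .
qed

text \<open>The free algebra acts here instead of its quotient, which avoids choosing cosets. The
  zero vector and negatives are the cases \<open>p = 0\<close> and \<open>p = - 1\<close>.\<close>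

definition is_sub :: "'v set \<Rightarrow> bool" where
  "is_sub W \<longleftrightarrow> W \<subseteq> carrier V \<and> W \<noteq> {} \<and> (\<forall>x\<in>W. \<forall>y\<in>W. x \<oplus> y \<in> W) \<and> (\<forall>x\<in>W. \<forall>p. p \<bullet> x \<in> W)"

lemma submodule_iff: "submodule W (H_alg N M l) V \<longleftrightarrow> is_sub W"
proof
  assume W: "submodule W (H_alg N M l) V"
  then interpret submodule W "H_alg N M l" V .
  have "W \<noteq> {}" using subgroup.one_closed[OF submodule.axioms(1)[OF W]] by auto
  then show "is_sub W"
    using subgroup.subset[OF submodule.axioms(1)[OF W]] subgroup.m_closed[OF submodule.axioms(1)[OF W]]
      smult_closed[OF H_class_hom(1)]
    unfolding is_sub_def act_def by auto
next
  assume W: "is_sub W"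
  have "\<ominus> x \<in> W" if "x \<in> W" for x
    using W that app_uminus[of x 1] unfolding is_sub_def by (metis app_one subsetD)
  then have "subgroup W (add_monoid V)"
    using W by (intro add.subgroupI) (auto simp: is_sub_def a_inv_def)
  then show "submodule W (H_alg N M l) V"
    using W unfolding submodule_def submodule_axioms_def is_sub_def act_def
    by (auto elim!: H_class_cases)
qed

lemma is_sub_zero: "is_sub W \<Longrightarrow> \<zero> \<in> W"
  unfolding is_sub_def by (metis app_zero ex_in_conv subsetD)

lemma simple_iff:
  "simple_module (H_alg N M l) V \<longleftrightarrow>
    carrier V \<noteq> {\<zero>} \<and> (\<forall>W. is_sub W \<longrightarrow> W = {\<zero>} \<or> W = carrier V)"
  unfolding simple_module_def submodule_iff using left_module_H by auto

end

section \<open>Homomorphisms and Schur's lemma\<close>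

locale H_hom = V: H_module N M l V + W: H_module N M l W
  for N M :: nat and l :: "'k::field \<times> 'k \<times> 'k" and V :: "('k, 'v) H_mod" and W :: "('k, 'w) H_mod" +
  fixes f :: "'v \<Rightarrow> 'w"
  assumes closed: "x \<in> carrier V \<Longrightarrow> f x \<in> carrier W"
    and add: "x \<in> carrier V \<Longrightarrow> y \<in> carrier V \<Longrightarrow> f (x \<oplus>\<^bsub>V\<^esub> y) = f x \<oplus>\<^bsub>W\<^esub> f y"
    and const: "x \<in> carrier V \<Longrightarrow> f (act N M l V (const c) x) = act N M l W (const c) (f x)"
    and gen: "x \<in> carrier V \<Longrightarrow> f (act N M l V (gen a) x) = act N M l W (gen a) (f x)"
begin

lemma act: "x \<in> carrier V \<Longrightarrow> f (act N M l V p x) = act N M l W p (f x)"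
  by (induction p arbitrary: x rule: free_alg_induct)
     (auto simp: const gen add closed V.app_add W.app_add V.app_mult W.app_mult)

lemma zero: "f \<zero>\<^bsub>V\<^esub> = \<zero>\<^bsub>W\<^esub>"
  using act[of "\<zero>\<^bsub>V\<^esub>" 0] by (simp add: closed)

lemma schur:
  assumes "simple_module (H_alg N M l) V" "simple_module (H_alg N M l) W"
    and "x0 \<in> carrier V" "f x0 \<noteq> \<zero>\<^bsub>W\<^esub>"
  shows "bij_betw f (carrier V) (carrier W)"
proof -
  have "V.is_sub {x \<in> carrier V. f x = \<zero>\<^bsub>W\<^esub>}"
    unfolding V.is_sub_def using zero by (auto simp: add act)
  then have ker: "{x \<in> carrier V. f x = \<zero>\<^bsub>W\<^esub>} = {\<zero>\<^bsub>V\<^esub>}"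
    using assms unfolding V.simple_iff by blast
  have "W.is_sub (f ` carrier V)"
    unfolding W.is_sub_def by (auto simp: closed add[symmetric] act[symmetric])
  then have img: "f ` carrier V = carrier W"
    using assms unfolding W.simple_iff by blast
  have "inj_on f (carrier V)"
  proof (rule inj_onI)
    fix x y assume xy: "x \<in> carrier V" "y \<in> carrier V" "f x = f y"
    have "f (x \<oplus>\<^bsub>V\<^esub> act N M l V (- 1) y) = f x \<oplus>\<^bsub>W\<^esub> act N M l W (- 1) (f y)"
      using xy by (simp add: add act)
    also have "\<dots> = \<zero>\<^bsub>W\<^esub>" using xy by (simp add: W.app_uminus closed W.r_neg)
    finally have "x \<oplus>\<^bsub>V\<^esub> act N M l V (- 1) y = \<zero>\<^bsub>V\<^esub>" using ker xy by blast
    then show "x = y" using xy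
      by (simp add: V.app_uminus) (metis V.add.inv_closed V.minus_equality V.minus_minus)
  qed
  then show ?thesis using img by (simp add: bij_betw_def)
qed

end

text \<open>The inverse of \<open>f\<close> is the isomorphism. Maps are constructed out of the
  modules of the list, whereas the classification compares a given module with the list in the
  opposite direction.\<close>

lemma module_isoI:
  assumes "bij_betw f (carrier V) (carrier W)"
    and "H_hom N M l V W f"
  shows "module_iso (H_alg N M l) W V"
proof -
  interpret H_hom N M l V W f by fact
  let ?g = "inv_into (carrier V) f"
  have g: "?g y \<in> carrier V" "f (?g y) = y" if "y \<in> carrier W" for y
    using assms(1) that by (auto simp: bij_betw_def inv_into_into f_inv_into_f)
  have gf: "?g (f x) = x" if "x \<in> carrier V" for x
    using assms(1) that by (auto simp: bij_betw_def)
  have 1: "bij_betw ?g (carrier W) (carrier V)" by (rule bij_betw_inv_into[OF assms(1)])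
  have 2: "?g (x \<oplus>\<^bsub>W\<^esub> y) = ?g x \<oplus>\<^bsub>V\<^esub> ?g y" if "x \<in> carrier W" "y \<in> carrier W" for x y
    using gf[of "?g x \<oplus>\<^bsub>V\<^esub> ?g y"] add[of "?g x" "?g y"] that by (simp add: g)
  have 3: "?g (act N M l W p x) = act N M l V p (?g x)" if "x \<in> carrier W" for x p
    using gf[of "act N M l V p (?g x)"] act[of "?g x" p] that by (simp add: g)
  show ?thesis unfolding module_iso_def using 1 2 3
    by (intro exI[of _ ?g]) (auto simp: act_def elim!: H_class_cases)
qed

lemma module_isoE:
  assumes "module_iso (H_alg N M l) V W" "H_module N M l V" "H_module N M l W"
  obtains f where "H_hom N M l V W f" "bij_betw f (carrier V) (carrier W)"
proof -
  obtain f where f: "bij_betw f (carrier V) (carrier W)"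
     "\<And>x y. x\<in>carrier V \<Longrightarrow> y\<in>carrier V \<Longrightarrow> f (x \<oplus>\<^bsub>V\<^esub> y) = f x \<oplus>\<^bsub>W\<^esub> f y"
     "\<And>a x. a\<in>carrier (H_alg N M l) \<Longrightarrow> x\<in>carrier V \<Longrightarrow> f (a \<odot>\<^bsub>V\<^esub> x) = a \<odot>\<^bsub>W\<^esub> f x"
    using assms(1) unfolding module_iso_def by metis
  have "H_hom N M l V W f"
    using f assms unfolding H_hom_def H_hom_axioms_def act_def
    by (auto simp: H_class_hom bij_betw_def)
  then show ?thesis using that f by auto
qed

section \<open>Modules given by operators on functions\<close>

text \<open>Linear operators assigned to the letters extend to the free algebra. The invariant
  subspace \<open>C\<close> is recorded because the relations will hold on it and not on all
  functions: coordinates beyond the basis are set to zero by the operators.\<close>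

locale free_rep =
  fixes op :: "letter \<Rightarrow> (nat \<Rightarrow> 'k::field) \<Rightarrow> nat \<Rightarrow> 'k" and C :: "(nat \<Rightarrow> 'k) set"
  assumes op_add: "op a (\<lambda>j. u j + v j) = (\<lambda>j. op a u j + op a v j)"
    and op_scale: "op a (\<lambda>j. c * u j) = (\<lambda>j. c * op a u j)"
    and C_zero: "(\<lambda>_. 0) \<in> C"
    and C_add: "u \<in> C \<Longrightarrow> v \<in> C \<Longrightarrow> (\<lambda>j. u j + v j) \<in> C"
    and C_scale: "u \<in> C \<Longrightarrow> (\<lambda>j. c * u j) \<in> C"
    and C_op: "u \<in> C \<Longrightarrow> op a u \<in> C"
begin

fun word_op :: "word \<Rightarrow> (nat \<Rightarrow> 'k) \<Rightarrow> nat \<Rightarrow> 'k" where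
  "word_op (Word w) u = foldr op w u"

definition alg_op :: "'k free_alg \<Rightarrow> (nat \<Rightarrow> 'k) \<Rightarrow> nat \<Rightarrow> 'k" where
  "alg_op p u = (\<lambda>j. \<Sum>w\<in>Poly_Mapping.keys p. Poly_Mapping.lookup p w * word_op w u j)"

text \<open>The scalars are cosets, so a representative is picked by \<open>SOME\<close>;
  \<open>act_as_module\<close> shows that the choice does not matter once the relations act by zero
  on \<open>C\<close>.\<close>

definition as_module :: "('k, nat \<Rightarrow> 'k) H_mod" where
  "as_module = \<lparr>carrier = C, monoid.mult = (\<lambda>u v. u), one = (\<lambda>_. 0), zero = (\<lambda>_. 0),
     add = (\<lambda>u v j. u j + v j), module.smult = (\<lambda>X u. alg_op (SOME p. p \<in> X) u)\<rparr>"

lemma word_op_add: "word_op w (\<lambda>j. u j + v j) = (\<lambda>j. word_op w u j + word_op w v j)"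
proof (cases w)
  case (Word w)
  show ?thesis unfolding Word by (induction w) (simp_all add: op_add)
qed

lemma word_op_scale: "word_op w (\<lambda>j. c * u j) = (\<lambda>j. c * word_op w u j)"
proof (cases w)
  case (Word w)
  show ?thesis unfolding Word by (induction w) (simp_all add: op_scale)
qed

lemma word_op_mult: "word_op (v + w) u = word_op v (word_op w u)"
  by (cases v; cases w) simp

lemma word_op_sum: "word_op w (\<lambda>j. \<Sum>i\<in>A. f i j) = (\<lambda>j. \<Sum>i\<in>A. word_op w (f i) j)"
proof (induction A rule: infinite_finite_induct)
  case (insert x F) then show ?case by (simp add: word_op_add)
qed (use word_op_scale[of w 0 "\<lambda>_. 0"] in simp_all)

lemma alg_op_superset:
  "finite A \<Longrightarrow> Poly_Mapping.keys p \<subseteq> A \<Longrightarrow>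
    alg_op p u j = (\<Sum>w\<in>A. Poly_Mapping.lookup p w * word_op w u j)"
  unfolding alg_op_def by (intro sum.mono_neutral_left) (auto simp: in_keys_iff)

lemma alg_op_add: "alg_op (p + q) u = (\<lambda>j. alg_op p u j + alg_op q u j)"
proof
  fix j
  let ?A = "Poly_Mapping.keys p \<union> Poly_Mapping.keys q"
  show "alg_op (p + q) u j = alg_op p u j + alg_op q u j"
    using keys_add[of p q]
    by (simp add: alg_op_superset[of ?A] lookup_add distrib_right sum.distrib)
qed

lemma alg_op_zero [simp]: "alg_op 0 u = (\<lambda>_. 0)"
  by (simp add: alg_op_def)

lemma alg_op_sum: "alg_op (\<Sum>i\<in>A. f i) u = (\<lambda>j. \<Sum>i\<in>A. alg_op (f i) u j)"
  by (induction A rule: infinite_finite_induct) (simp_all add: alg_op_add)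

lemma alg_op_single: "alg_op (Poly_Mapping.single w c) u = (\<lambda>j. c * word_op w u j)"
  by (cases "c = 0") (simp_all add: alg_op_def)

lemma alg_op_mult: "alg_op (p * q) u = alg_op p (alg_op q u)"
proof -
  let ?s = "\<lambda>p w. Poly_Mapping.single w (Poly_Mapping.lookup p w)"
  \<comment> \<open>Both factors are expanded into monomials, for which the claim is
    \<open>word_op_mult\<close>.\<close>
  have "p * q = (\<Sum>w\<in>Poly_Mapping.keys p. \<Sum>v\<in>Poly_Mapping.keys q. ?s p w * ?s q v)"
    by (subst (1) poly_mapping_eq_sum_single[of p], subst (1) poly_mapping_eq_sum_single[of q])
       (simp only: sum_product)
  then show ?thesis
    by (simp add: alg_op_sum mult_single alg_op_single word_op_mult)
       (simp add: alg_op_def word_op_sum word_op_scale sum_distrib_left mult.assoc)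
qed

lemma alg_op_const [simp]: "alg_op (const c) u = (\<lambda>j. c * u j)"
  by (simp add: const_def alg_op_single zero_word_def)

lemma alg_op_gen [simp]: "alg_op (gen x) u = op x u"
  by (simp add: gen_def alg_op_single)

lemma alg_op_gen_fun: "alg_op (gen x) = op x"
  by (rule ext) simp

lemma alg_op_one [simp]: "alg_op 1 u = u"
  using alg_op_const[of 1 u] by (simp add: const_hom)

lemma alg_op_uminus: "alg_op (- p) u = (\<lambda>j. - alg_op p u j)"
proof -
  have "alg_op (- p) u = alg_op (const (- 1) * p) u" by (simp add: const_hom)
  then show ?thesis by (simp only: alg_op_mult alg_op_const) simp
qed

lemma alg_op_diff: "alg_op (p - q) u = (\<lambda>j. alg_op p u j - alg_op q u j)"
  using alg_op_add[of p "- q" u] by (simp add: alg_op_uminus)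

lemma alg_op_power: "alg_op (p ^ n) u = (alg_op p ^^ n) u"
  by (induction n) (simp_all add: alg_op_mult)

lemma alg_op_closed: "u \<in> C \<Longrightarrow> alg_op p u \<in> C"
  by (induction p arbitrary: u rule: free_alg_induct)
     (simp_all add: C_scale C_op alg_op_add C_add alg_op_mult)

lemma alg_op_add_right: "alg_op p (\<lambda>j. u j + v j) = (\<lambda>j. alg_op p u j + alg_op p v j)"
  by (induction p arbitrary: u v rule: free_alg_induct)
     (simp_all add: alg_op_add alg_op_mult op_add algebra_simps)

lemma alg_op_zero_right: "alg_op p (\<lambda>j. 0) = (\<lambda>j. 0)"
proof
  fix j
  have "alg_op p (\<lambda>j. 0) j = alg_op p (\<lambda>j. 0) j + alg_op p (\<lambda>j. 0) j"
    using fun_cong[OF alg_op_add_right[of p "\<lambda>_. 0" "\<lambda>_. 0"], of j] by (simp only: add_0)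
  then show "alg_op p (\<lambda>j. 0) j = 0" by (simp only: add_cancel_right_right)
qed

lemma as_module_simps [simp]:
  "carrier as_module = C" "zero as_module = (\<lambda>_. 0)" "add as_module = (\<lambda>u v j. u j + v j)"
  by (simp_all add: as_module_def)

lemma finsum_as_module:
  assumes "abelian_group as_module"
  shows "finite A \<Longrightarrow> f \<in> A \<rightarrow> C \<Longrightarrow> (\<Oplus>\<^bsub>as_module\<^esub>i\<in>A. f i) = (\<lambda>j. \<Sum>i\<in>A. f i j)"
proof -
  interpret abelian_group as_module by fact
  show "finite A \<Longrightarrow> f \<in> A \<rightarrow> C \<Longrightarrow> ?thesis"
    by (induction A rule: finite_induct) (simp_all add: Pi_def)
qed

context
  fixes N M :: nat and l :: "'k \<times> 'k \<times> 'k"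
  assumes relations: "\<And>r u. r \<in> H_relations N M l \<Longrightarrow> u \<in> C \<Longrightarrow> alg_op r u = (\<lambda>_. 0)"
begin

text \<open>The vector is generalized in the induction: in a right multiple the given element is
  applied to the image of \<open>u\<close>, which lies in \<open>C\<close> again.\<close>

lemma alg_op_ideal: "p \<in> H_ideal N M l \<Longrightarrow> u \<in> C \<Longrightarrow> alg_op p u = (\<lambda>_. 0)"
  by (induction p arbitrary: u rule: H_ideal_induct)
     (simp_all add: relations alg_op_add alg_op_mult alg_op_zero_right alg_op_closed)

lemma act_as_module:
  assumes "u \<in> C" shows "act N M l as_module p u = alg_op p u"
proof -
  define q where "q = (SOME q. q \<in> H_class N M l p)"
  have "q \<in> H_class N M l p" unfolding q_def by (rule someI) (rule mem_H_class_self)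
  then have "alg_op (q - p) u = (\<lambda>_. 0)"
    using alg_op_ideal assms by (simp add: mem_H_class_iff)
  then show ?thesis by (simp add: act_def as_module_def q_def[symmetric] alg_op_diff fun_eq_iff)
qed

lemma H_module_as_module: "H_module N M l as_module"
proof (rule H_module.intro)
  have A: "abelian_group as_module"
  proof (rule abelian_groupI)
    fix u assume "u \<in> carrier as_module"
    then show "\<exists>v\<in>carrier as_module. v \<oplus>\<^bsub>as_module\<^esub> u = \<zero>\<^bsub>as_module\<^esub>"
      by (intro bexI[of _ "\<lambda>j. - 1 * u j"]) (simp_all only: as_module_simps C_scale, simp)
  qed (auto simp: C_zero C_add algebra_simps)
  show "left_module (H_alg N M l) as_module"
  proof (intro left_module.intro left_module_axioms.intro ring_H_alg A)
    show "\<one>\<^bsub>H_alg N M l\<^esub> \<odot>\<^bsub>as_module\<^esub> x = x" if "x \<in> carrier as_module" for x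
      using that act_as_module[of x 1] by (simp add: act_def H_class_hom)
  qed (auto elim!: H_class_cases simp: act_def[symmetric] H_class_hom(2,3)[symmetric] act_as_module
        alg_op_add alg_op_mult alg_op_closed alg_op_add_right C_add)
qed

end

end

section \<open>The modules of the list\<close>

fun basis_types :: "'k::field label \<Rightarrow> ('k \<times> 'k) list" where
  "basis_types (L1 \<chi>) = [\<chi>]"
| "basis_types (L2h \<chi>) = [\<chi>, bar_char \<chi>]"
| "basis_types (L2v \<chi>) = [\<chi>, neg_char \<chi>]"
| "basis_types (L4 \<chi> d) = [\<chi>, bar_char \<chi>, neg_char (bar_char \<chi>), neg_char \<chi>]"

abbreviation dim :: "'k::field label \<Rightarrow> nat" where "dim x \<equiv> length (basis_types x)"

text \<open>Each generator \<open>a\<close> sends the \<open>i\<close>-th basis vector to \<open>coef l a x i\<close> times the basis vector with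
  index \<open>perm a x i\<close>, where \<open>perm a x\<close> is an involution.\<close>

fun perm :: "letter \<Rightarrow> 'k::field label \<Rightarrow> nat \<Rightarrow> nat" where
  "perm La1 (L2h \<chi>) i = [1, 0] ! i"
| "perm La1 (L4 \<chi> d) i = [1, 0, 3, 2] ! i"
| "perm La2 (L2v \<chi>) i = [1, 0] ! i"
| "perm La2 (L4 \<chi> d) i = [3, 2, 1, 0] ! i"
| "perm _ _ i = i"

fun coef :: "'k \<times> 'k \<times> 'k \<Rightarrow> letter \<Rightarrow> 'k::field label \<Rightarrow> nat \<Rightarrow> 'k" where
  "coef l Lg1 x i = fst (basis_types x ! i)"
| "coef l Lg2 x i = snd (basis_types x ! i)"
| "coef l La1 (L2h \<chi>) i = [1, alpha1 l \<chi>] ! i"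
| "coef l La1 (L4 \<chi> d) i = [1, alpha1 l \<chi>, 1, alpha1 l \<chi>] ! i"
| "coef l La2 (L2v \<chi>) i = [1, alpha2 l \<chi>] ! i"
| "coef l La2 (L4 \<chi> d) i = [d, 1, alpha2 l \<chi>, c_of l \<chi> d] ! i"
| "coef l _ _ i = 0"

text \<open>The j-th coordinate of the image comes from the one index that is sent to
  \<open>j\<close>, and this is \<open>perm a x j\<close> because \<open>perm a x\<close> is its own
  inverse.\<close>

definition label_op :: "'k \<times> 'k \<times> 'k \<Rightarrow> 'k::field label \<Rightarrow> letter \<Rightarrow> (nat \<Rightarrow> 'k) \<Rightarrow> nat \<Rightarrow> 'k" where
  "label_op l x a u = (\<lambda>j. if j < dim x then coef l a x (perm a x j) * u (perm a x j) else 0)"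

text \<open>Coordinate vectors padded by zeros, so that dimensions 1, 2 and 4 share one
  type.\<close>

definition label_carrier :: "'k::field label \<Rightarrow> (nat \<Rightarrow> 'k) set" where
  "label_carrier x = {u. \<forall>j\<ge>dim x. u j = 0}"

interpretation label: free_rep "label_op l x" "label_carrier x" for l x
  by unfold_locales (auto simp: label_op_def label_carrier_def fun_eq_iff algebra_simps)

abbreviation label_module :: "'k \<times> 'k \<times> 'k \<Rightarrow> 'k::field label \<Rightarrow> ('k, nat \<Rightarrow> 'k) H_mod" where
  "label_module \<equiv> label.as_module"

fun label_char :: "'k label \<Rightarrow> 'k \<times> 'k" where
  "label_char (L1 \<chi>) = \<chi>"
| "label_char (L2h \<chi>) = \<chi>"
| "label_char (L2v \<chi>) = \<chi>"
| "label_char (L4 \<chi> d) = \<chi>"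

text \<open>The types occurring in one module differ only by signs. Since the alphas see only
  squares, they are constant on the module.\<close>

lemma basis_types_square:
  assumes "j < dim x"
  shows "fst (basis_types x ! j) ^ 2 = fst (label_char x) ^ 2"
    "snd (basis_types x ! j) ^ 2 = snd (label_char x) ^ 2"
  using assms by (cases x; auto simp: less_Suc_eq numeral_eq_Suc)+

lemma basis_types_alpha [simp]:
  assumes "j < dim x"
  shows "alpha1 l (basis_types x ! j) = alpha1 l (label_char x)"
    "alpha2 l (basis_types x ! j) = alpha2 l (label_char x)"
    "alpha3 l (basis_types x ! j) = alpha3 l (label_char x)"
  using basis_types_square[OF assms] by (simp_all add: alpha_altdef)

lemma label_char_chars: "x \<in> labels N M l \<Longrightarrow> label_char x \<in> chars N M"
  by (auto simp: labels_def O1_def O2_def O4_def)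

lemma label_op_powers:
  assumes "u \<in> label_carrier x" "j < dim x"
  shows "(label_op l x Lg1 ^^ n) u j = fst (basis_types x ! j) ^ n * u j"
  "(label_op l x Lg2 ^^ n) u j = snd (basis_types x ! j) ^ n * u j"
  using assms by (induction n) (auto simp: label_op_def)

lemma perm_involution:
  assumes "x \<in> labels N M l" "j < dim x"
  shows "perm a x j < dim x" "perm a x (perm a x j) = j"
  using assms by (cases a; cases x; auto simp: less_Suc_eq numeral_eq_Suc)+

text \<open>The first identity is the quadratic equation for \<open>d\<close> and expresses
  \<open>a2 (a2 v1)\<close>; the second is the quartic relation at \<open>v1\<close>, whose two
  summands act there by \<open>c\<close> and by \<open>alpha1^2 * alpha2 * d\<close>. If
  \<open>c = 0\<close>, then \<open>alpha2\<close> and \<open>alpha3\<close> vanish, which would put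
  \<chi> into \<open>O1\<close> or \<open>O2\<close>.\<close>

lemma label_L4_scalars:
  assumes "L4 \<chi> d \<in> labels N M l"
  shows "c_of l \<chi> d * d = alpha2 l \<chi>" "c_of l \<chi> d + alpha1 l \<chi> ^ 2 * alpha2 l \<chi> * d = alpha3 l \<chi>"
    "c_of l \<chi> d \<noteq> 0"
proof -
  have d: "alpha1 l \<chi> ^ 2 * alpha2 l \<chi> * d ^ 2 - alpha3 l \<chi> * d + alpha2 l \<chi> = 0" "\<chi> \<in> O4 N M l"
    using assms by (auto simp: labels_def)
  show 1: "c_of l \<chi> d * d = alpha2 l \<chi>" "c_of l \<chi> d + alpha1 l \<chi> ^ 2 * alpha2 l \<chi> * d = alpha3 l \<chi>"
    using d by (simp_all add: c_of_def algebra_simps power2_eq_square)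
  show "c_of l \<chi> d \<noteq> 0"
    using 1 d(2) by (auto simp: O4_def O2_def O1_def)
qed

text \<open>Checked one coordinate at a time. The right-hand sides of the quadratic and quartic
  relations involve only the diagonal operators of \<open>g1\<close>, \<open>g2\<close> and become
  the alphas; the left-hand sides follow the arrows between basis vectors.\<close>

lemma label_relations:
  assumes "x \<in> labels N M l" "r \<in> H_relations N M l" "u \<in> label_carrier x"
  shows "label.alg_op l x r u = (\<lambda>_. 0)"
proof
  fix j
  show "label.alg_op l x r u j = 0"
  proof (cases "j < dim x")
    case False
    then show ?thesis using label.alg_op_closed[OF assms(3), of l r] by (simp add: label_carrier_def)
  next
    case j: True
    let ?op = "label_op l x"
    note alg = label.alg_op_add label.alg_op_diff label.alg_op_mult label.alg_op_uminus
      label.alg_op_power power2_eq_square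
    define t where "t = basis_types x ! j"
    have tN: "fst t ^ (2 * N) = 1" "snd t ^ (2 * M) = 1"
      using label_char_chars[OF assms(1)] basis_types_square[OF j]
      by (auto simp: chars_def roots_of_1_def power_mult t_def)
    have g: "?op Lg1 v j = fst t * v j" "?op Lg2 v j = snd t * v j" for v
      using j by (auto simp: label_op_def t_def)
    have R8: "label.alg_op l x (const (fst l) * (1 - gen Lg1 ^ 2)) u j = alpha1 l (label_char x) * u j"
      unfolding basis_types_alpha(1)[OF j, of l, folded t_def, symmetric] by (simp add: alg g alpha_altdef algebra_simps)
    have R9: "label.alg_op l x (const (fst (snd l)) * (1 - gen Lg2 ^ 2)) u j = alpha2 l (label_char x) * u j"
      unfolding basis_types_alpha(2)[OF j, of l, folded t_def, symmetric] by (simp add: alg g alpha_altdef algebra_simps)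
    define r3 where "r3 = const (snd (snd l)) * (1 - gen Lg1 ^ 2 * gen Lg2 ^ 2)
            - const (2 * fst l * fst (snd l)) * (1 + gen Lg2 ^ 2) * (1 - gen Lg1 ^ 2)"
    have R10: "label.alg_op l x r3 u j = alpha3 l (label_char x) * u j"
      unfolding r3_def basis_types_alpha(3)[OF j, of l, folded t_def, symmetric] by (simp add: alg g alpha_altdef algebra_simps)
    have g1: "(?op Lg1 ^^ (2 * N)) u j = u j" and g2: "(?op Lg2 ^^ (2 * M)) u j = u j"
      using label_op_powers[OF assms(3) j, where l = l] tN by (simp_all add: t_def)
    {
    note [simp] = label_op_def less_Suc_eq numeral_eq_Suc
    have A11: "?op La1 (?op La1 u) j = alpha1 l (label_char x) * u j"
      using assms(1) j by (cases x) (auto simp: labels_def O1_def O2_def)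
    have "?op La2 (?op La2 u) j = alpha2 l (label_char x) * u j \<and>
        ?op La1 (?op La2 (?op La1 (?op La2 u))) j + ?op La2 (?op La1 (?op La2 (?op La1 u))) j
        = alpha3 l (label_char x) * u j"
    \<comment> \<open>Only \<open>L4\<close> involves the parameters \<open>c\<close> and
      \<open>d\<close>. In the other modules \<open>a1\<close> or \<open>a2\<close> is zero and
      \<open>alpha3\<close> vanishes.\<close>
    proof (cases "\<exists>\<chi> d. x = L4 \<chi> d")
      case True
      then obtain \<chi> d where x: "x = L4 \<chi> d" by blast
      show ?thesis using j label_L4_scalars(1,2)[OF assms(1)[unfolded x], symmetric] unfolding x
        by (auto simp: algebra_simps)
    next
      case False
      then show ?thesis using assms(1) j by (cases x) (auto simp: labels_def O1_def O2_def)
    qed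
    then have A22: "?op La2 (?op La2 u) j = alpha2 l (label_char x) * u j"
      and A12: "?op La1 (?op La2 (?op La1 (?op La2 u))) j + ?op La2 (?op La1 (?op La2 (?op La1 u))) j
        = alpha3 l (label_char x) * u j" by blast+
    have G12: "?op Lg1 (?op Lg2 u) j = ?op Lg2 (?op Lg1 u) j" by simp
    have G11: "?op Lg1 (?op La1 u) j = - ?op La1 (?op Lg1 u) j"
      using j by (cases x) auto
    have G1A2: "?op Lg1 (?op La2 u) j = - ?op La2 (?op Lg1 u) j"
      using j by (cases x) auto
    have G21: "?op Lg2 (?op La1 u) j = ?op La1 (?op Lg2 u) j"
      using j by (cases x) auto
    have G22: "?op Lg2 (?op La2 u) j = - ?op La2 (?op Lg2 u) j"
      using j by (cases x) auto
    note A = A11 A22 A12 G12 G11 G1A2 G21 G22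
    }
    note A = this
    from assms(2) show ?thesis
      unfolding H_relations_altdef Let_def r3_def[symmetric]
      by (elim insertE emptyE; hypsubst)
        (simp_all only: label.alg_op_diff R8 R9 R10,
         simp_all add: label.alg_op_mult label.alg_op_add label.alg_op_uminus power2_eq_square A,
         simp_all add: label.alg_op_power label.alg_op_gen_fun g1 g2 del: power_mult)
  qed
qed

lemma label_module_H_module: "x \<in> labels N M l \<Longrightarrow> H_module N M l (label_module l x)"
  by (rule label.H_module_as_module) (rule label_relations)

lemma act_label_module:
  "x \<in> labels N M l \<Longrightarrow> u \<in> label_carrier x \<Longrightarrow> act N M l (label_module l x) p u = label.alg_op l x p u"
  by (rule label.act_as_module) (rule label_relations)

definition unit_vec :: "nat \<Rightarrow> nat \<Rightarrow> 'k::field" where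
  "unit_vec i = (\<lambda>j. if j = i then 1 else 0)"

lemma unit_vec_carrier [simp]: "i < dim x \<Longrightarrow> unit_vec i \<in> label_carrier x"
  by (auto simp: unit_vec_def label_carrier_def)

lemma label_op_unit_vec:
  assumes "x \<in> labels N M l" "i < dim x"
  shows "label_op l x a (unit_vec i) = (\<lambda>j. coef l a x i * unit_vec (perm a x i) j)"
proof
  fix j
  have "perm a x j = i \<longleftrightarrow> j = perm a x i" if "j < dim x"
    using perm_involution(2)[OF assms, of a] perm_involution(2)[OF assms(1) that, of a] by metis
  then show "label_op l x a (unit_vec i) j = coef l a x i * unit_vec (perm a x i) j"
    using perm_involution(1)[OF assms, of a] by (auto simp: label_op_def unit_vec_def)
qed

lemma finsum_label_module:
  assumes "x \<in> labels N M l"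
  shows "(\<Oplus>\<^bsub>label_module l x\<^esub>i\<in>{..<dim x}. act N M l (label_module l x) (const (c i)) (unit_vec i))
    = (\<lambda>j. if j < dim x then c j else 0)"
proof -
  interpret H_module N M l "label_module l x" by (rule label_module_H_module[OF assms])
  have "(\<Oplus>\<^bsub>label_module l x\<^esub>i\<in>{..<dim x}. act N M l (label_module l x) (const (c i)) (unit_vec i))
     = (\<Oplus>\<^bsub>label_module l x\<^esub>i\<in>{..<dim x}. (\<lambda>j. c i * unit_vec i j))"
    by (rule finsum_cong') (auto simp: act_label_module[OF assms] label.C_scale)
  also have "\<dots> = (\<lambda>j. \<Sum>i<dim x. c i * unit_vec i j)"
    by (rule label.finsum_as_module) (auto simp: label.C_scale abelian_group_axioms)
  also have "\<dots> = (\<lambda>j. if j < dim x then c j else 0)"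
    by (auto simp: unit_vec_def fun_eq_iff if_distrib cong: if_cong)
  finally show ?thesis .
qed

lemma is_basis_unit_vec:
  assumes "x \<in> labels N M l"
  shows "is_basis N M l (label_module l x) (map unit_vec [0..<dim x])"
  unfolding is_basis_def
proof (intro conjI ballI)
  show "set (map unit_vec [0..<dim x]) \<subseteq> carrier (label_module l x)" by auto
  interpret H_module N M l "label_module l x" by (rule label_module_H_module[OF assms])
  let ?vs = "map unit_vec [0..<dim x] :: (nat \<Rightarrow> 'a) list"
  have *: "(\<Oplus>\<^bsub>label_module l x\<^esub>i\<in>{..<length ?vs}. act N M l (label_module l x) (const (cs ! i)) (?vs ! i))
     = (\<lambda>j. if j < dim x then cs ! j else 0)" for cs
    unfolding finsum_label_module[OF assms, symmetric]
    by (rule finsum_cong') (auto simp: act_label_module[OF assms] label.C_scale)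
  fix u assume "u \<in> carrier (label_module l x)"
  then have "u \<in> label_carrier x" by simp
  then have u: "\<forall>j\<ge>dim x. u j = 0" unfolding label_carrier_def by simp
  show "\<exists>!cs. length cs = length ?vs \<and>
      u = (\<Oplus>\<^bsub>label_module l x\<^esub>i\<in>{..<length ?vs}. act N M l (label_module l x) (const (cs ! i)) (?vs ! i))"
    unfolding *
    by (rule ex1I[of _ "map u [0..<dim x]"]) (use u in \<open>auto simp: fun_eq_iff intro: nth_equalityI\<close>)
qed

lemma act_gen_unit_vec:
  assumes "x \<in> labels N M l" "i < dim x"
  shows "act N M l (label_module l x) (gen a) (unit_vec i) =
      act N M l (label_module l x) (const (coef l a x i)) (unit_vec (perm a x i))"
  using assms perm_involution(1)[OF assms]
  by (simp add: act_label_module[OF assms(1)] label_op_unit_vec[OF assms(1)])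

lemma has_form_label_module:
  assumes x: "x \<in> labels N M l"
  shows "has_form N M l x (label_module l x)"
proof -
  interpret H_module N M l "label_module l x" by (rule label_module_H_module[OF x])
  note b = is_basis_unit_vec[OF x]
  note * = act_gen_unit_vec
  have t: "of_type N M l (label_module l x) (basis_types x ! i) (unit_vec i)" if "i < dim x" for i
    using that *[OF x that, of Lg1] *[OF x that, of Lg2] by (simp add: of_type_def)
  have u: "unit_vec i \<in> carrier (label_module l x)" if "i < dim x" for i using that by simp
  note s = scale_zero[OF u] scale_one[OF u]
  show ?thesis
  proof (cases x)
    case [simp]: (L1 \<chi>)
    show ?thesis using x left_module_H b t[of 0] s[of 0] by (auto simp: * intro!: exI[of _ "unit_vec 0"])
  next
    case [simp]: (L2h \<chi>)
    show ?thesis using x left_module_H b t[of 0] t[of 1] s[of 0] s[of 1]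
      unfolding L2h has_form.simps
      by (intro conjI[OF left_module_H[unfolded L2h]],
          rule_tac exI[of _ "unit_vec 0"], rule_tac exI[of _ "unit_vec 1"])
         (auto simp: * numeral_eq_Suc)
  next
    case [simp]: (L2v \<chi>)
    show ?thesis using x left_module_H b t[of 0] t[of 1] s[of 0] s[of 1]
      unfolding L2v has_form.simps
      by (intro conjI[OF left_module_H[unfolded L2v]],
          rule_tac exI[of _ "unit_vec 0"], rule_tac exI[of _ "unit_vec 1"])
         (auto simp: * numeral_eq_Suc)
  next
    case [simp]: (L4 \<chi> d)
    show ?thesis using x left_module_H b t[of 0] t[of 1] t[of 2] t[of 3] s[of 0] s[of 1] s[of 2] s[of 3]
      unfolding L4 has_form.simps
      by (intro conjI[OF left_module_H[unfolded L4]],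
          rule_tac exI[of _ "unit_vec 0"], rule_tac exI[of _ "unit_vec 1"],
          rule_tac exI[of _ "unit_vec 2"], rule_tac exI[of _ "unit_vec 3"])
         (auto simp: * numeral_eq_Suc)
  qed
qed

section \<open>Simplicity of the modules of the list\<close>

lemma chars_nonzero:
  assumes "\<chi> \<in> chars N M" "N \<ge> 1" "M \<ge> 1"
  shows "fst \<chi> \<noteq> 0" "snd \<chi> \<noteq> 0"
  using assms by (auto simp: chars_def roots_of_1_def power_0_left)

lemma add_sign_types_eq_zero:
  fixes x :: "'k::field_char_0 label"
  assumes "label_char x \<in> chars N M" "N \<ge> 1" "M \<ge> 1" "i < dim x" "j < dim x" "i \<noteq> j"
  shows "fst (basis_types x ! i) + fst (basis_types x ! j) = 0 \<or> snd (basis_types x ! i) + snd (basis_types x ! j) = 0"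
  using assms by (cases x) (auto simp: less_Suc_eq numeral_eq_Suc)

lemma basis_types_nonzero:
  assumes "label_char x \<in> chars N M" "N \<ge> 1" "M \<ge> 1" "j < dim x"
  shows "fst (basis_types x ! j) \<noteq> 0" "snd (basis_types x ! j) \<noteq> 0"
  using basis_types_square[OF assms(4)] chars_nonzero[OF assms(1-3)] by (metis power_eq_0_iff zero_power2)+

text \<open>If (t1, t2) is the type of the j-th basis vector, then (g1 + t1)(g2 + t2) multiplies
  that vector by 4 t1 t2, which is nonzero. Any other basis vector has the opposite sign in at least
  one coordinate of its type and is killed by the corresponding factor.\<close>

lemma unit_vec_projection:
  fixes x :: "'k::field_char_0 label" and l :: "'k \<times> 'k \<times> 'k"
  assumes "label_char x \<in> chars N M" "N \<ge> 1" "M \<ge> 1" "j < dim x" "u \<in> label_carrier x" "u j \<noteq> 0"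
  obtains p where "label.alg_op l x p u = unit_vec j"
proof -
  let ?t1 = "fst (basis_types x ! j)" and ?t2 = "snd (basis_types x ! j)"
  let ?c = "4 * ?t1 * ?t2 * u j"
  have c: "?c \<noteq> 0" using basis_types_nonzero[OF assms(1-4)] assms(6) by simp
  let ?p = "const (inverse ?c) * ((gen Lg1 + const ?t1) * (gen Lg2 + const ?t2))"
  have "label.alg_op l x ?p u i = unit_vec j i" for i
  proof (cases "i < dim x")
    case False
    then show ?thesis using label.alg_op_closed[OF assms(5), of l ?p] assms(4)
      by (auto simp: label_carrier_def unit_vec_def)
  next
    case True
    have "label.alg_op l x ?p u i = inverse ?c * ((fst (basis_types x ! i) + ?t1) * (snd (basis_types x ! i) + ?t2) * u i)"
      using True by (simp add: label.alg_op_mult label.alg_op_add label_op_def algebra_simps)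
    also have "\<dots> = unit_vec j i"
    proof (cases "i = j")
      case True
      have "(?t1 + ?t1) * (?t2 + ?t2) * u j = ?c" by (simp add: algebra_simps)
      then show ?thesis unfolding True by (simp only: left_inverse[OF c]) (simp add: unit_vec_def)
    next
      case False
      then have "(fst (basis_types x ! i) + ?t1) * (snd (basis_types x ! i) + ?t2) = 0"
        using add_sign_types_eq_zero[OF assms(1-3) True assms(4)] by auto
      then show ?thesis using False by (simp only: mult_zero_left mult_zero_right) (simp add: unit_vec_def)
    qed
    finally show ?thesis .
  qed
  then show ?thesis using that by blast
qed

text \<open>A nonzero vector of a submodule can be projected to a basis vector, and arrows with
  nonzero coefficients lead from there to all the others.\<close>

lemma simple_label_module:
  fixes l :: "'k::field_char_0 \<times> 'k \<times> 'k"
  assumes x: "x \<in> labels N M l" and NM: "N \<ge> 1" "M \<ge> 1"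
  shows "simple_module (H_alg N M l) (label_module l x)"
proof -
  interpret H_module N M l "label_module l x" by (rule label_module_H_module[OF x])
  note ch = label_char_chars[OF x]
  show ?thesis unfolding simple_iff
  proof (intro conjI allI impI)
    have d: "0 < dim x" by (cases x) auto
    have "unit_vec 0 \<noteq> (\<lambda>_. 0 :: 'k)" by (auto simp: unit_vec_def fun_eq_iff)
    then show "carrier (label_module l x) \<noteq> {\<zero>\<^bsub>label_module l x\<^esub>}" using unit_vec_carrier[OF d] by auto
    fix W assume W: "is_sub W"
    have Wc: "u \<in> label_carrier x" if "u \<in> W" for u using W that by (auto simp: is_sub_def)
    have Wact: "label.alg_op l x p u \<in> W" if "u \<in> W" for p u
      using W that Wc[OF that] unfolding is_sub_def by (metis act_label_module[OF x])
    show "W = {\<zero>\<^bsub>label_module l x\<^esub>} \<or> W = carrier (label_module l x)"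
    proof (cases "W \<subseteq> {\<zero>\<^bsub>label_module l x\<^esub>}")
      case True
      then show ?thesis using W by (auto simp: is_sub_def)
    next
      case False
      then obtain u j where u: "u \<in> W" "u j \<noteq> 0" by (auto simp: fun_eq_iff)
      have j: "j < dim x" using u Wc[OF u(1)] by (auto simp: label_carrier_def intro: ccontr)
      obtain p where "label.alg_op l x p u = unit_vec j"
        using unit_vec_projection[OF ch NM j Wc[OF u(1)] u(2)] by blast
      then have ej: "unit_vec j \<in> W" using Wact[OF u(1)] by metis
      have step: "unit_vec (perm a x i) \<in> W" if "i < dim x" "coef l a x i \<noteq> 0" "unit_vec i \<in> W" for a i
        using Wact[OF that(3), of "const (inverse (coef l a x i)) * gen a"] that
        by (simp add: label.alg_op_mult label_op_unit_vec[OF x] mult.assoc[symmetric])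
      have all: "unit_vec i \<in> W" if "i < dim x" for i
      proof (cases x)
        case [simp]: (L1 \<chi>) show ?thesis using ej j that by simp
      next
        case [simp]: (L2h \<chi>)
        have "alpha1 l \<chi> \<noteq> 0" using x by (auto simp: labels_def)
        then show ?thesis using ej j that step[of 0 La1] step[of 1 La1] by (auto simp: less_Suc_eq numeral_eq_Suc)
      next
        case [simp]: (L2v \<chi>)
        have "alpha2 l \<chi> \<noteq> 0" using x by (auto simp: labels_def)
        then show ?thesis using ej j that step[of 0 La2] step[of 1 La2] by (auto simp: less_Suc_eq numeral_eq_Suc)
      next
        case [simp]: (L4 \<chi> d)
        have c: "c_of l \<chi> d \<noteq> 0" using label_L4_scalars[of \<chi> d N M l] x by simp
        \<comment> \<open>The cycle v1, v2, v3, v4, v1 has the coefficients 1, 1, 1,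
          \<open>c\<close>. It avoids \<open>d\<close>, \<open>alpha1\<close> and
          \<open>alpha2\<close>, each of which may vanish.\<close>
        have "unit_vec 0 \<in> W \<Longrightarrow> unit_vec 1 \<in> W" "unit_vec 1 \<in> W \<Longrightarrow> unit_vec 2 \<in> W"
           "unit_vec 2 \<in> W \<Longrightarrow> unit_vec 3 \<in> W" "unit_vec 3 \<in> W \<Longrightarrow> unit_vec 0 \<in> W"
          using c step[of 0 La1] step[of 1 La2] step[of 2 La1] step[of 3 La2] by (simp_all add: numeral_eq_Suc)
        then show ?thesis using ej j that by (auto simp: less_Suc_eq numeral_eq_Suc)
      qed
      have "w \<in> W" if w: "w \<in> label_carrier x" for w
      proof -
        have "(\<Oplus>\<^bsub>label_module l x\<^esub>i\<in>A. act N M l (label_module l x) (const (w i)) (unit_vec i)) \<in> W"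
          if "finite A" "A \<subseteq> {..<dim x}" for A
          using that
        proof (induction A rule: finite_induct)
          case empty then show ?case using is_sub_zero[OF W] by simp
        next
          case (insert i A)
          have "act N M l (label_module l x) (const (w i)) (unit_vec i) \<in> W"
            using W all[of i] insert.prems by (auto simp: is_sub_def)
          moreover have "act N M l (label_module l x) (const (w k)) (unit_vec k) \<in> label_carrier x"
            if "k < dim x" for k
            using that by (simp add: act_label_module[OF x] label.C_scale)
          ultimately show ?case using insert W
            by (subst finsum_insert) (auto simp: is_sub_def Pi_def subset_iff)
        qed
        from this[of "{..<dim x}"] have "(\<lambda>j. if j < dim x then w j else 0) \<in> W"
          by (simp add: finsum_label_module[OF x])
        moreover have "(\<lambda>j. if j < dim x then w j else 0) = w" using w by (auto simp: label_carrier_def)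
        ultimately show ?thesis by simp
      qed
      then show ?thesis using Wc by auto
    qed
  qed
qed

section \<open>Distinguishing the modules\<close>

definition spectrum :: "nat \<Rightarrow> nat \<Rightarrow> 'k \<times> 'k \<times> 'k \<Rightarrow> ('k::field, 'v) H_mod \<Rightarrow> (('k \<times> 'k) \<times> 'k) set" where
  "spectrum N M l V = {(\<chi>, t). \<exists>v. v \<noteq> \<zero>\<^bsub>V\<^esub> \<and> of_type N M l V \<chi> v \<and>
     act N M l V (gen La2 * gen La1 * gen La2 * gen La1) v = act N M l V (const t) v}"

lemma spectrum_iso:
  assumes "module_iso (H_alg N M l) V W" "H_module N M l V" "H_module N M l W"
  shows "spectrum N M l V \<subseteq> spectrum N M l W"
proof -
  obtain f where f: "H_hom N M l V W f" "bij_betw f (carrier V) (carrier W)"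
    using module_isoE[OF assms] by blast
  interpret H_hom N M l V W f by (rule f(1))
  have "f v \<noteq> \<zero>\<^bsub>W\<^esub>" if "v \<in> carrier V" "v \<noteq> \<zero>\<^bsub>V\<^esub>" for v
    using f(2) that zero unfolding bij_betw_def inj_on_def by (metis V.zero_closed)
  then have "f v \<noteq> \<zero>\<^bsub>W\<^esub> \<and> of_type N M l W \<chi> (f v) \<and>
      act N M l W (gen La2 * gen La1 * gen La2 * gen La1) (f v) = act N M l W (const t) (f v)"
    if "v \<noteq> \<zero>\<^bsub>V\<^esub> \<and> of_type N M l V \<chi> v \<and>
      act N M l V (gen La2 * gen La1 * gen La2 * gen La1) v = act N M l V (const t) v" for v \<chi> t
    using that by (auto simp: of_type_def closed act[symmetric])
  then show ?thesis unfolding spectrum_def by blast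
qed

text \<open>The diagonal entries of a2 a1 a2 a1. On \<open>L4\<close> the operator runs through the
  four-cycle: starting at \<open>v1\<close> or \<open>v3\<close> this gives \<open>c\<close>, while
  starting at \<open>v2\<close> or \<open>v4\<close> it runs backwards and gives
  \<open>alpha1^2 * alpha2 * d\<close>, which equals \<open>alpha3 - c\<close>. On the other modules
  \<open>a1\<close> or \<open>a2\<close> is zero.\<close>

fun eigenvalue :: "'k \<times> 'k \<times> 'k \<Rightarrow> 'k::field label \<Rightarrow> nat \<Rightarrow> 'k" where
  "eigenvalue l (L4 \<chi> d) i =
    [c_of l \<chi> d, alpha3 l \<chi> - c_of l \<chi> d, c_of l \<chi> d, alpha3 l \<chi> - c_of l \<chi> d] ! i"
| "eigenvalue l x i = 0"

lemma a2121_label_module: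
  assumes "x \<in> labels N M l" "j < dim x"
  shows "label.alg_op l x (gen La2 * gen La1 * gen La2 * gen La1) u j = eigenvalue l x j * u j"
proof (cases "\<exists>\<chi> d. x = L4 \<chi> d")
  case True
  then obtain \<chi> d where x: "x = L4 \<chi> d" by blast
  show ?thesis using assms label_L4_scalars(2)[OF assms(1)[unfolded x], symmetric] unfolding x
    by (auto simp: label.alg_op_mult label_op_def less_Suc_eq numeral_eq_Suc algebra_simps)
next
  case False
  then show ?thesis using assms
    by (cases x) (auto simp: label.alg_op_mult label_op_def less_Suc_eq numeral_eq_Suc)
qed

text \<open>All three operators are diagonal in the unit vectors, so the eigenvalues of a common
  eigenvector can be read off at any coordinate where it does not vanish.\<close>

lemma spectrum_label_module:
  assumes x: "x \<in> labels N M l"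
  shows "spectrum N M l (label_module l x) = (\<lambda>j. (basis_types x ! j, eigenvalue l x j)) ` {..<dim x}"
proof (intro equalityI subsetI)
  interpret H_module N M l "label_module l x" by (rule label_module_H_module[OF x])
  fix s assume "s \<in> spectrum N M l (label_module l x)"
  then obtain \<chi> t u where s: "s = (\<chi>, t)" "u \<noteq> (\<lambda>_. 0)" "u \<in> label_carrier x"
     "label_op l x Lg1 u = (\<lambda>j. fst \<chi> * u j)" "label_op l x Lg2 u = (\<lambda>j. snd \<chi> * u j)"
     "label.alg_op l x (gen La2 * gen La1 * gen La2 * gen La1) u = (\<lambda>j. t * u j)"
    by (auto simp: spectrum_def of_type_def act_label_module[OF x])
  obtain j where j: "j < dim x" "u j \<noteq> 0"
    using s(2,3) by (auto simp: label_carrier_def fun_eq_iff) (meson not_le)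
  have "fst (basis_types x ! j) = fst \<chi>" "snd (basis_types x ! j) = snd \<chi>" "eigenvalue l x j = t"
    using fun_cong[OF s(4), of j] fun_cong[OF s(5), of j] fun_cong[OF s(6), of j] j
      a2121_label_module[OF x j(1), of u]
    by (simp_all add: label_op_def)
  then show "s \<in> (\<lambda>j. (basis_types x ! j, eigenvalue l x j)) ` {..<dim x}"
    using j s(1) by (auto intro!: image_eqI[of _ _ j] prod_eqI)
next
  fix s assume "s \<in> (\<lambda>j. (basis_types x ! j, eigenvalue l x j)) ` {..<dim x}"
  then obtain j where j: "j < dim x" "s = (basis_types x ! j, eigenvalue l x j)" by auto
  have "label.alg_op l x (gen La2 * gen La1 * gen La2 * gen La1) (unit_vec j)
     = (\<lambda>i. eigenvalue l x j * unit_vec j i)"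
  proof
    fix i
    show "label.alg_op l x (gen La2 * gen La1 * gen La2 * gen La1) (unit_vec j) i
      = eigenvalue l x j * unit_vec j i"
      using a2121_label_module[OF x, of i "unit_vec j"] j
        label.alg_op_closed[OF unit_vec_carrier[OF j(1)], of l "gen La2 * gen La1 * gen La2 * gen La1"]
      by (cases "i < dim x") (auto simp: unit_vec_def label_carrier_def)
  qed
  then show "s \<in> spectrum N M l (label_module l x)"
    using j by (auto simp: spectrum_def of_type_def act_label_module[OF x] label_op_unit_vec[OF x] fun_eq_iff
       intro!: exI[of _ "unit_vec j"]) (auto simp: unit_vec_def)
qed

lemma mem_labels_iff:
  "L1 \<chi> \<in> labels N M l \<longleftrightarrow> \<chi> \<in> O1 N M l"
  "L2h \<chi> \<in> labels N M l \<longleftrightarrow> \<chi> \<in> O2 N M l \<and> alpha1 l \<chi> \<noteq> 0"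
  "L2v \<chi> \<in> labels N M l \<longleftrightarrow> \<chi> \<in> O2 N M l \<and> alpha2 l \<chi> \<noteq> 0"
  "L4 \<chi> d \<in> labels N M l \<longleftrightarrow> \<chi> \<in> O4 N M l \<and>
     alpha1 l \<chi> ^ 2 * alpha2 l \<chi> * d ^ 2 - alpha3 l \<chi> * d + alpha2 l \<chi> = 0"
  by (cases \<chi>; auto simp: labels_def)+

section \<open>Eigenvectors\<close>

text \<open>Horner evaluation of a scalar polynomial at an element of a noncommutative algebra. It
  is compatible with splitting off linear factors because constants are central.\<close>

definition alg_eval :: "'k::field free_alg \<Rightarrow> 'k poly \<Rightarrow> 'k free_alg" where
  "alg_eval q p = fold_coeffs (\<lambda>c r. const c + q * r) p 0"

lemma alg_eval_0 [simp]: "alg_eval q 0 = 0"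
  by (simp add: alg_eval_def)

lemma alg_eval_pCons [simp]: "alg_eval q (pCons c p) = const c + q * alg_eval q p"
  by (cases "p = 0 \<and> c = 0") (auto simp: alg_eval_def const_hom)

lemma alg_eval_add: "alg_eval q (p + r) = alg_eval q p + alg_eval q r"
  by (induction p r rule: poly_induct2) (simp_all add: const_hom algebra_simps)

lemma alg_eval_smult: "alg_eval q (Polynomial.smult c p) = const c * alg_eval q p"
proof (induction p)
  case (pCons a p)
  have "q * (const c * alg_eval q p) = const c * (q * alg_eval q p)"
    by (metis const_commute mult.assoc)
  then show ?case by (simp add: pCons const_hom distrib_left)
qed simp

lemma alg_eval_linear: "alg_eval q ([:- r, 1:] * p) = (q - const r) * alg_eval q p"
proof -
  have "[:- r, 1:] * p = Polynomial.smult (- r) p + pCons 0 p" by simp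
  then show ?thesis
    by (simp only: alg_eval_add alg_eval_smult alg_eval_pCons const_hom) (simp add: algebra_simps)
qed

lemma alg_eval_unity: "alg_eval q (Polynomial.monom 1 n - 1) = q ^ n - 1"
proof -
  have "alg_eval q (Polynomial.monom 1 n) = q ^ n"
    by (induction n) (simp_all add: monom_Suc monom_0 const_hom)
  moreover have "alg_eval q (- 1) = - 1" by (simp add: one_pCons const_hom)
  ultimately show ?thesis using alg_eval_add[of q "Polynomial.monom 1 n" "- 1"] by simp
qed

locale H_module_closed_field = H_module N M l V
  for N M :: nat and l :: "'k::{alg_closed_field, field_char_0} \<times> 'k \<times> 'k" and V :: "('k, 'v) H_mod" (structure)
begin

text \<open>Split off a root, \<open>p = (X - r) * s\<close>. If \<open>s\<close> at
  \<open>q\<close> already kills \<open>v\<close>, the degree drops; otherwise the image of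
  \<open>v\<close> under it is an eigenvector for \<open>r\<close>. A stable subspace
  \<open>W\<close> is carried along so that the lemma can be used again inside an
  eigenspace.\<close>

lemma eigenvector_poly:
  assumes "p \<noteq> 0" "alg_eval q p \<bullet> v = \<zero>" "v \<in> W" "v \<noteq> \<zero>"
    and W: "W \<subseteq> carrier V" "\<And>x y. x \<in> W \<Longrightarrow> y \<in> W \<Longrightarrow> x \<oplus> y \<in> W" "\<And>c x. x \<in> W \<Longrightarrow> c *\<^sub>V x \<in> W"
      "\<And>x. x \<in> W \<Longrightarrow> q \<bullet> x \<in> W"
  shows "\<exists>w\<in>W. w \<noteq> \<zero> \<and> (\<exists>c. q \<bullet> w = c *\<^sub>V w)"
  using assms(1,2)
proof (induction "degree p" arbitrary: p)
  case 0
  then obtain c where "p = [:c:]" "c \<noteq> 0" by (metis degree_eq_zeroE pCons_0_0)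
  then show ?case using 0 assms W scale_eq_zero[of v c] by auto
next
  case (Suc n)
  have v: "v \<in> carrier V" using assms W by auto
  obtain r where "poly p r = 0" using alg_closed_imp_poly_has_root[of p] Suc by auto
  then obtain s where s: "p = [:- r, 1:] * s" by (meson poly_eq_0_iff_dvd dvdE)
  have "s \<noteq> 0" using s Suc by auto
  have deg: "n = degree s" using Suc(2) \<open>s \<noteq> 0\<close> degree_mult_eq[of "[:- r, 1:]" s] unfolding s by simp
  show ?case
  proof (cases "alg_eval q s \<bullet> v = \<zero>")
    case True then show ?thesis using Suc(1)[OF deg \<open>s \<noteq> 0\<close>] by simp
  next
    case False
    have "alg_eval q s \<bullet> v \<in> W"
    proof (induction s)
      case 0 then show ?case using W(3)[OF assms(3), of 0] v by (simp add: const_hom)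
    next
      case (pCons c s) then show ?case using W assms v by (simp add: app_add app_mult)
    qed
    moreover have "q \<bullet> alg_eval q s \<bullet> v \<ominus> r *\<^sub>V alg_eval q s \<bullet> v = \<zero>"
      using Suc(4) v unfolding s alg_eval_linear by (simp add: app_mult app_diff)
    then have "q \<bullet> alg_eval q s \<bullet> v = r *\<^sub>V alg_eval q s \<bullet> v"
      using v by (metis a_inv_closed a_minus_def app_closed minus_equality minus_minus)
    ultimately show ?thesis using False by blast
  qed
qed

lemma eigenvector_unity:
  assumes "n \<ge> 1" "\<And>v. v \<in> carrier V \<Longrightarrow> (q ^ n) \<bullet> v = v" "v \<in> W" "v \<noteq> \<zero>"
    and W: "W \<subseteq> carrier V" "\<And>x y. x \<in> W \<Longrightarrow> y \<in> W \<Longrightarrow> x \<oplus> y \<in> W" "\<And>c x. x \<in> W \<Longrightarrow> c *\<^sub>V x \<in> W"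
      "\<And>x. x \<in> W \<Longrightarrow> q \<bullet> x \<in> W"
  obtains w c where "w \<in> W" "w \<noteq> \<zero>" "q \<bullet> w = c *\<^sub>V w" "c ^ n = 1"
proof -
  have v: "v \<in> carrier V" using assms W by auto
  have "Polynomial.monom (1 :: 'k) n \<noteq> 1"
    using assms(1) by (metis degree_1 degree_monom_eq not_one_le_zero one_neq_zero)
  then have "Polynomial.monom (1 :: 'k) n - 1 \<noteq> 0" by simp
  moreover have "alg_eval q (Polynomial.monom 1 n - 1) \<bullet> v = \<zero>"
    using assms(2)[OF v] v by (simp add: alg_eval_unity app_diff r_neg a_minus_def)
  ultimately have "\<exists>w\<in>W. w \<noteq> \<zero> \<and> (\<exists>c. q \<bullet> w = c *\<^sub>V w)"
    by (rule eigenvector_poly) fact+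
  then obtain w c where w: "w \<in> W" "w \<noteq> \<zero>" "q \<bullet> w = c *\<^sub>V w" by blast
  have wc: "w \<in> carrier V" using w W by auto
  have "((\<bullet>) q ^^ k) w = (c ^ k) *\<^sub>V w" for k
  proof (induction k)
    case (Suc k)
    have "q \<bullet> (c ^ k) *\<^sub>V w = (c ^ k) *\<^sub>V q \<bullet> w" by (rule app_commute[OF wc const_commute[symmetric]])
    then show ?case using wc by (simp add: Suc w mult.commute)
  qed (use wc in simp)
  then have "(c ^ n) *\<^sub>V w = 1 *\<^sub>V w" using assms(2)[OF wc] wc by (simp add: app_power)
  then have "c ^ n = 1" using scale_cancel[OF wc] w by blast
  then show ?thesis using that w by blast
qed

lemma exists_typed_vector:
  assumes "N \<ge> 1" "M \<ge> 1" "carrier V \<noteq> {\<zero>}"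
  obtains \<chi> v where "\<chi> \<in> chars N M" "oftype \<chi> v" "v \<noteq> \<zero>"
proof -
  have r: "(gen Lg1 ^ (2 * N)) \<bullet> v = v" "(gen Lg2 ^ (2 * M)) \<bullet> v = v" if "v \<in> carrier V" for v
    using relation_eq[of "gen Lg1 ^ (2 * N)" 1 v] relation_eq[of "gen Lg2 ^ (2 * M)" 1 v] that
    by (simp_all add: H_relations_altdef Let_def)
  obtain v where v: "v \<in> carrier V" "v \<noteq> \<zero>" using assms(3) zero_closed by blast
  obtain w x where w: "w \<in> carrier V" "w \<noteq> \<zero>" "gen Lg1 \<bullet> w = x *\<^sub>V w" "x ^ (2 * N) = 1"
    by (rule eigenvector_unity[OF _ r(1) v]) (use assms in auto)
  \<comment> \<open>The eigenspace of \<open>g1\<close> is stable under \<open>g2\<close> because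
    the two commute, so a second application inside it yields a common eigenvector.\<close>
  obtain u y where "u \<in> {u \<in> carrier V. gen Lg1 \<bullet> u = x *\<^sub>V u}" "u \<noteq> \<zero>" "gen Lg2 \<bullet> u = y *\<^sub>V u" "y ^ (2 * M) = 1"
    by (rule eigenvector_unity[OF _ r(2), of w "{u \<in> carrier V. gen Lg1 \<bullet> u = x *\<^sub>V u}"])
       (use assms w in \<open>auto simp: app_add_right mult.commute g1_g2\<close>)
  then show ?thesis using that[of "(x, y)" u] w
    by (auto simp: chars_def roots_of_1_def of_type_def)
qed

end

section \<open>Homomorphisms from the modules of the list\<close>

context H_module
begin

text \<open>A map out of a module of the list is determined by images \<open>vs\<close> of the basis
  vectors that satisfy the same formulas; they may be linearly dependent or zero.\<close>

lemma hom_from_label_module: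
  assumes x: "x \<in> labels N M l"
    and vs: "\<And>i. i < dim x \<Longrightarrow> vs i \<in> carrier V"
    and gens: "\<And>a i. i < dim x \<Longrightarrow> gen a \<bullet> vs i = coef l a x i *\<^sub>V vs (perm a x i)"
  shows "H_hom N M l (label_module l x) V (\<lambda>u. \<Oplus>i\<in>{..<dim x}. u i *\<^sub>V vs i)"
proof -
  note pc = perm_involution[OF x]
  show ?thesis
  proof (intro H_hom.intro label_module_H_module[OF x] H_module_axioms H_hom_axioms.intro)
    fix u w :: "nat \<Rightarrow> 'k" and c and a :: letter
    assume "u \<in> carrier (label_module l x)"
    then have u: "u \<in> label_carrier x" by simp
    show "(\<Oplus>i\<in>{..<dim x}. u i *\<^sub>V vs i) \<in> carrier V"
      using vs by (intro finsum_closed) auto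
    show "(\<Oplus>i\<in>{..<dim x}. (u \<oplus>\<^bsub>label_module l x\<^esub> w) i *\<^sub>V vs i)
       = (\<Oplus>i\<in>{..<dim x}. u i *\<^sub>V vs i) \<oplus> (\<Oplus>i\<in>{..<dim x}. w i *\<^sub>V vs i)"
    proof -
      have "(\<Oplus>i\<in>{..<dim x}. (u \<oplus>\<^bsub>label_module l x\<^esub> w) i *\<^sub>V vs i)
         = (\<Oplus>i\<in>{..<dim x}. u i *\<^sub>V vs i \<oplus> w i *\<^sub>V vs i)"
        using vs by (intro finsum_cong') (auto simp: scale_add)
      also have "\<dots> = (\<Oplus>i\<in>{..<dim x}. u i *\<^sub>V vs i) \<oplus> (\<Oplus>i\<in>{..<dim x}. w i *\<^sub>V vs i)"
        using vs by (intro finsum_addf) auto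
      finally show ?thesis .
    qed
    show "(\<Oplus>i\<in>{..<dim x}. act N M l (label_module l x) (const c) u i *\<^sub>V vs i)
       = c *\<^sub>V (\<Oplus>i\<in>{..<dim x}. u i *\<^sub>V vs i)"
      using vs by (subst app_finsum) (auto simp: act_label_module[OF x u] intro!: finsum_cong')
    have "(\<Oplus>i\<in>{..<dim x}. act N M l (label_module l x) (gen a) u i *\<^sub>V vs i)
       = (\<Oplus>i\<in>{..<dim x}. (coef l a x (perm a x i) * u (perm a x i)) *\<^sub>V vs i)"
      using vs by (intro finsum_cong') (auto simp: act_label_module[OF x u] label_op_def)
    \<comment> \<open>The sum is reindexed along the involution: reading coordinates at
      \<open>perm a x i\<close> becomes moving the vectors to
      \<open>vs (perm a x i)\<close>.\<close>
    also have "\<dots> = (\<Oplus>i\<in>perm a x ` {..<dim x}. (coef l a x (perm a x i) * u (perm a x i)) *\<^sub>V vs i)"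
    proof -
      have "perm a x ` {..<dim x} = {..<dim x}"
        using pc(1,2) by (auto simp: image_iff) (metis lessThan_iff)
      then show ?thesis by (simp only:)
    qed
    also have "(\<Oplus>i\<in>perm a x ` {..<dim x}. (coef l a x (perm a x i) * u (perm a x i)) *\<^sub>V vs i)
       = (\<Oplus>i\<in>{..<dim x}. (coef l a x i * u i) *\<^sub>V vs (perm a x i))"
      using vs pc(1,2)
      by (subst finsum_reindex) (auto intro!: finsum_cong' inj_on_inverseI[of _ "perm a x"])
    also have "\<dots> = (\<Oplus>i\<in>{..<dim x}. gen a \<bullet> u i *\<^sub>V vs i)"
      using vs pc(1,2) by (intro finsum_cong') (auto simp: gens mult.commute)
    also have "\<dots> = gen a \<bullet> (\<Oplus>i\<in>{..<dim x}. u i *\<^sub>V vs i)"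
      using vs by (subst app_finsum) auto
    finally show "(\<Oplus>i\<in>{..<dim x}. act N M l (label_module l x) (gen a) u i *\<^sub>V vs i)
      = gen a \<bullet> (\<Oplus>i\<in>{..<dim x}. u i *\<^sub>V vs i)" .
  qed
qed

end

context H_module_closed_field
begin

context
  assumes NM: "N \<ge> 1" "M \<ge> 1" and simple: "simple_module (H_alg N M l) V"
begin

text \<open>Both modules are simple, and the map sends the first basis vector to
  \<open>vs 0\<close>, so Schur's lemma requires no more than
  \<open>vs 0 \<noteq> \<zero>\<close>.\<close>

lemma iso_label_module:
  assumes x: "x \<in> labels N M l"
    and vs: "\<And>i. i < dim x \<Longrightarrow> oftype (basis_types x ! i) (vs i)"
    and gens: "\<And>i. i < dim x \<Longrightarrow> a1 (vs i) = coef l La1 x i *\<^sub>V vs (perm La1 x i)"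
       "\<And>i. i < dim x \<Longrightarrow> a2 (vs i) = coef l La2 x i *\<^sub>V vs (perm La2 x i)"
    and nz: "vs 0 \<noteq> \<zero>"
  shows "module_iso (H_alg N M l) V (label_module l x)"
proof -
  have vsc: "\<And>i. i < dim x \<Longrightarrow> vs i \<in> carrier V" using vs of_type_closed by blast
  have "gen a \<bullet> vs i = coef l a x i *\<^sub>V vs (perm a x i)" if "i < dim x" for a i
    using gens of_type_g[OF vs] that by (cases a) auto
  then have hom: "H_hom N M l (label_module l x) V (\<lambda>u. \<Oplus>i\<in>{..<dim x}. u i *\<^sub>V vs i)"
    by (intro hom_from_label_module x vsc)
  interpret H_hom N M l "label_module l x" V "\<lambda>u. \<Oplus>i\<in>{..<dim x}. u i *\<^sub>V vs i" by (rule hom)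
  have d: "0 < dim x" by (cases x) auto
  have "(\<Oplus>i\<in>{..<dim x}. unit_vec 0 i *\<^sub>V vs i) = (\<Oplus>i\<in>{..<dim x}. if 0 = i then vs i else \<zero>)"
    using vsc d by (intro finsum_cong') (auto simp: unit_vec_def)
  also have "\<dots> = vs 0" using vsc d by (subst finsum_singleton) auto
  finally have "bij_betw (\<lambda>u. \<Oplus>i\<in>{..<dim x}. u i *\<^sub>V vs i) (carrier (label_module l x)) (carrier V)"
    using nz d by (intro schur[OF simple_label_module[OF x NM] simple, of "unit_vec 0"]) auto
  then show ?thesis by (rule module_isoI) (rule hom)
qed

lemma iso_L1:
  assumes "\<chi> \<in> O1 N M l" "oftype \<chi> v" "v \<noteq> \<zero>" "a1 v = \<zero>" "a2 v = \<zero>"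
  shows "module_iso (H_alg N M l) V (label_module l (L1 \<chi>))"
  using assms of_type_closed[OF assms(2)]
  by (intro iso_label_module[of _ "\<lambda>_. v"]) (auto simp: mem_labels_iff)

lemma iso_L2h:
  assumes "\<chi> \<in> O2 N M l" "alpha1 l \<chi> \<noteq> 0" "oftype \<chi> v" "v \<noteq> \<zero>" "a2 v = \<zero>" "a2 (a1 v) = \<zero>"
  shows "module_iso (H_alg N M l) V (label_module l (L2h \<chi>))"
  using assms of_type_closed[OF assms(3)] of_type_a1[OF assms(3)] a1_a1[OF assms(3)]
  by (intro iso_label_module[of _ "\<lambda>i. [v, a1 v] ! i"]) (auto simp: mem_labels_iff less_Suc_eq)

lemma iso_L2v:
  assumes "\<chi> \<in> O2 N M l" "alpha2 l \<chi> \<noteq> 0" "oftype \<chi> v" "v \<noteq> \<zero>" "a1 v = \<zero>" "a1 (a2 v) = \<zero>"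
  shows "module_iso (H_alg N M l) V (label_module l (L2v \<chi>))"
  using assms of_type_closed[OF assms(3)] of_type_a2[OF assms(3)] a2_a2[OF assms(3)]
  by (intro iso_label_module[of _ "\<lambda>i. [v, a2 v] ! i"]) (auto simp: mem_labels_iff less_Suc_eq)

text \<open>Applying \<open>a2\<close> to the eigenvalue equation gives the formula for
  \<open>a2 v\<close>. With it, a1 a2 a1 a2 acts on \<open>v\<close> by
  \<open>alpha1^2 * alpha2 * d\<close>, and the quartic relation turns this into
  \<open>alpha1^2 * alpha2 * d + t = alpha3\<close>. Hence \<open>c\<close> is \<open>t\<close>, and
  together with \<open>d * t = alpha2\<close> this is the quadratic equation for
  \<open>d\<close>.\<close>

lemma iso_L4:
  assumes chi: "\<chi> \<in> O4 N M l" and v: "oftype \<chi> v" "v \<noteq> \<zero>"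
    and t: "a2 (a1 (a2 (a1 v))) = t *\<^sub>V v" "t \<noteq> 0"
  defines "d \<equiv> alpha2 l \<chi> / t"
  shows "L4 \<chi> d \<in> labels N M l" "module_iso (H_alg N M l) V (label_module l (L4 \<chi> d))"
proof -
  have vc [simp]: "v \<in> carrier V" using v of_type_closed by blast
  note types = of_type_a1[OF v(1)] of_type_a2[OF of_type_a1[OF v(1)]]
     of_type_a1[OF of_type_a2[OF of_type_a1[OF v(1)]]]
  have "t *\<^sub>V a2 v = a2 (t *\<^sub>V v)" by simp
  also have "\<dots> = alpha2 l \<chi> *\<^sub>V a1 (a2 (a1 v))"
    unfolding t(1)[symmetric] using a2_a2[OF types(3)] by simp
  finally have "(inverse t * t) *\<^sub>V a2 v = (inverse t * alpha2 l \<chi>) *\<^sub>V a1 (a2 (a1 v))"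
    unfolding scale_scale[OF app_closed[OF vc], symmetric] by simp
  then have a2v: "a2 v = d *\<^sub>V a1 (a2 (a1 v))" using t(2) by (simp add: d_def field_simps)
  have "a1 (a2 (a1 (a2 v))) = (d * alpha1 l \<chi> * alpha2 l \<chi> * alpha1 l \<chi>) *\<^sub>V v"
    unfolding a2v using a1_a1[OF types(2)] a2_a2[OF types(1)] a1_a1[OF v(1)] by (simp add: mult_ac)
  then have "(d * alpha1 l \<chi> * alpha2 l \<chi> * alpha1 l \<chi> + t) *\<^sub>V v = alpha3 l \<chi> *\<^sub>V v"
    using a1212_a2121[OF v(1)] by (simp add: t scale_add)
  then have sum: "d * alpha1 l \<chi> * alpha2 l \<chi> * alpha1 l \<chi> + t = alpha3 l \<chi>"
    using scale_cancel[OF vc v(2)] by blast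
  then have c: "c_of l \<chi> d = t" by (simp add: c_of_def power2_eq_square sum[symmetric] algebra_simps)
  have "d * t = alpha2 l \<chi>" using t(2) by (simp add: d_def)
  then have "alpha1 l \<chi> ^ 2 * alpha2 l \<chi> * d ^ 2 - alpha3 l \<chi> * d + alpha2 l \<chi> = 0"
    unfolding sum[symmetric] by (simp add: power2_eq_square algebra_simps)
  then show *: "L4 \<chi> d \<in> labels N M l" using chi by (auto simp: mem_labels_iff)
  show "module_iso (H_alg N M l) V (label_module l (L4 \<chi> d))"
    by (rule iso_label_module[OF *, of "\<lambda>i. [v, a1 v, a2 (a1 v), a1 (a2 (a1 v))] ! i"])
       (use v types c t a2v a1_a1[OF v(1)] a1_a1[OF types(2)] a2_a2[OF types(1)] in
         \<open>auto simp: less_Suc_eq numeral_eq_Suc\<close>)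
qed

end

end

section \<open>Classification\<close>

text \<open>Picks one element from every pair \<open>{x, - x}\<close>.\<close>

definition pos :: "'k::field \<Rightarrow> bool" where
  "pos x \<longleftrightarrow> (SOME y. y \<in> {x, - x}) = x"

text \<open>The chosen element depends only on the set \<open>{x, - x}\<close>, which is the same
  for \<open>- x\<close>, and the two members differ since 2 is invertible.\<close>

lemma pos_uminus:
  fixes x :: "'k::field_char_0"
  assumes "x \<noteq> 0" shows "pos (- x) \<longleftrightarrow> \<not> pos x"
proof -
  have "(SOME y. y \<in> {x, - x}) \<in> {x, - x}" by (rule someI[of _ x]) simp
  moreover have "{- x, - (- x)} = {x, - x}" by auto
  moreover have "x \<noteq> - x" using assms by (metis add.inverse_inverse eq_neg_iff_add_eq_0 mult_2 mult_eq_0_iff zero_neq_numeral)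
  ultimately show ?thesis unfolding pos_def by auto
qed

text \<open>The two types in \<open>L2h\<close> or \<open>L2v\<close> have opposite first
  coordinates, so that sign is fixed. In \<open>L4\<close> with
  \<open>alpha1 * alpha2 \<noteq> 0\<close> any of the four types can serve as \<chi>, and both
  signs are fixed. If the product is 0, only the types of \<open>v1\<close> and \<open>v3\<close>
  carry the nonzero eigenvalue \<open>alpha3\<close>; they share the first coordinate, so only the
  sign of the second is fixed.\<close>

fun normalized :: "'k \<times> 'k \<times> 'k \<Rightarrow> 'k::field label \<Rightarrow> bool" where
  "normalized l (L1 \<chi>) = True"
| "normalized l (L2h \<chi>) = pos (fst \<chi>)"
| "normalized l (L2v \<chi>) = pos (fst \<chi>)"
| "normalized l (L4 \<chi> d) = (pos (snd \<chi>) \<and> (alpha1 l \<chi> * alpha2 l \<chi> \<noteq> 0 \<longrightarrow> pos (fst \<chi>)))"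

definition reps :: "nat \<Rightarrow> nat \<Rightarrow> 'k \<times> 'k \<times> 'k \<Rightarrow> 'k::field label set" where
  "reps N M l = {x \<in> labels N M l. normalized l x}"

lemma O_sign [simp]:
  "bar_char \<chi> \<in> chars N M \<longleftrightarrow> \<chi> \<in> chars N M" "neg_char \<chi> \<in> chars N M \<longleftrightarrow> \<chi> \<in> chars N M"
  "bar_char \<chi> \<in> O1 N M l \<longleftrightarrow> \<chi> \<in> O1 N M l" "neg_char \<chi> \<in> O1 N M l \<longleftrightarrow> \<chi> \<in> O1 N M l"
  "bar_char \<chi> \<in> O2 N M l \<longleftrightarrow> \<chi> \<in> O2 N M l" "neg_char \<chi> \<in> O2 N M l \<longleftrightarrow> \<chi> \<in> O2 N M l"
  "bar_char \<chi> \<in> O4 N M l \<longleftrightarrow> \<chi> \<in> O4 N M l" "neg_char \<chi> \<in> O4 N M l \<longleftrightarrow> \<chi> \<in> O4 N M l"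
proof -
  show *: "bar_char \<chi> \<in> chars N M \<longleftrightarrow> \<chi> \<in> chars N M" "neg_char \<chi> \<in> chars N M \<longleftrightarrow> \<chi> \<in> chars N M"
    by (cases \<chi>; auto simp: chars_def roots_of_1_def)+
  show "bar_char \<chi> \<in> O1 N M l \<longleftrightarrow> \<chi> \<in> O1 N M l" "neg_char \<chi> \<in> O1 N M l \<longleftrightarrow> \<chi> \<in> O1 N M l"
    "bar_char \<chi> \<in> O2 N M l \<longleftrightarrow> \<chi> \<in> O2 N M l" "neg_char \<chi> \<in> O2 N M l \<longleftrightarrow> \<chi> \<in> O2 N M l"
    "bar_char \<chi> \<in> O4 N M l \<longleftrightarrow> \<chi> \<in> O4 N M l" "neg_char \<chi> \<in> O4 N M l \<longleftrightarrow> \<chi> \<in> O4 N M l"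
    by (simp_all add: O1_def O2_def O4_def *)
qed

section \<open>Kernel vectors and eigenvectors of alternating products\<close>

context H_module
begin

text \<open>Used with {A, B} = {a1, a2} in the case \<open>O2\<close>. There \<open>P\<close> says
  that a vector has some type in a set closed under sign changes; it is stable under
  \<open>A\<close> and \<open>B\<close>, while additivity is not assumed.\<close>

lemma nilpotent_vector:
  fixes A B :: "'v \<Rightarrow> 'v"
  assumes P: "\<And>x. P x \<Longrightarrow> x \<in> carrier V \<and> P (A x) \<and> P (B x)"
    and AA: "\<And>x. P x \<Longrightarrow> A (A x) = \<zero>" and zero: "A \<zero> = \<zero>" "B \<zero> = \<zero>"
    and B: "\<And>x. P x \<Longrightarrow> B x = \<zero> \<Longrightarrow> x = \<zero>"
    and anti: "\<And>x. P x \<Longrightarrow> B (A (B (A x))) \<oplus> A (B (A (B x))) = \<zero>"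
    and v: "P v" "v \<noteq> \<zero>"
  obtains u where "P u" "u \<noteq> \<zero>" "A u = \<zero>" "A (B u) = \<zero>"
proof -
  define T where "T = (\<lambda>x. A (B (A (B x))))"
  have PT: "P (T x)" "P (A x)" "P (B x)" "x \<in> carrier V" if "P x" for x using P that by (auto simp: T_def)
  \<comment> \<open>\<open>A\<close> kills \<open>T v\<close> because \<open>A\<close> squares to
    zero, so the quartic relation at \<open>T v\<close> leaves only \<open>T (T v)\<close>.\<close>
  have "T (T v) = \<zero>"
    using anti[OF PT(1)[OF v(1)]] AA[OF PT(3)[OF PT(2)[OF PT(3)[OF v(1)]]]] PT(4)[OF PT(1)[OF PT(1)[OF v(1)]]] zero
    by (simp add: T_def)
  then have "\<exists>w. P w \<and> w \<noteq> \<zero> \<and> T w = \<zero>" using PT(1)[OF v(1)] v by metis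
  then obtain w where w: "P w" "w \<noteq> \<zero>" "T w = \<zero>"
    by blast
  have U: "B (A (B (A w))) = \<zero>"
    using anti[OF w(1)] w(3) PT(4)[OF PT(3)[OF PT(2)[OF PT(3)[OF PT(2)[OF w(1)]]]]] by (simp add: T_def)
  \<comment> \<open>The candidates are \<open>A (B w)\<close>, \<open>w\<close> and
    \<open>A w\<close>. For the first, \<open>A (B u)\<close> is \<open>T w\<close>; for the last,
    \<open>B\<close> kills \<open>A (B u)\<close> by the relation at \<open>w\<close>, and
    \<open>B\<close> has trivial kernel on \<open>P\<close>.\<close>
  show ?thesis
  proof (cases "A (B w) = \<zero>")
    case False
    have "P (A (B w))" "A (A (B w)) = \<zero>" using PT(2,3) AA w(1) by blast+
    then show ?thesis using that[of "A (B w)"] False w(3) unfolding T_def by blast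
  next
    case ABw: True
    show ?thesis
    proof (cases "A w = \<zero>")
      case True then show ?thesis using that[of w] ABw w by simp
    next
      case False
      have "P (A (B (A w)))" by (intro PT w(1))
      then have "A (B (A w)) = \<zero>" using B[OF _ U] by blast
      then show ?thesis using that[OF PT(2)[OF w(1)] False AA[OF w(1)]] by blast
    qed
  qed
qed

text \<open>Both operators square to zero, so only alternating words matter, and the quartic
  relation makes B A B A B vanish on \<open>v\<close>. If no common kernel vector existed, a word
  whose two one-letter extensions vanish on \<open>v\<close> would vanish there too, and shortening
  words would end in \<open>v = \<zero>\<close>.\<close>

lemma common_kernel_vector:
  fixes A B :: "'v \<Rightarrow> 'v"
  assumes P: "\<And>x. P x \<Longrightarrow> x \<in> carrier V \<and> P (A x) \<and> P (B x)"
    and AA: "\<And>x. P x \<Longrightarrow> A (A x) = \<zero>" "\<And>x. P x \<Longrightarrow> B (B x) = \<zero>" and zero: "A \<zero> = \<zero>" "B \<zero> = \<zero>"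
    and anti: "\<And>x. P x \<Longrightarrow> B (A (B (A x))) \<oplus> A (B (A (B x))) = \<zero>"
    and v: "P v" "v \<noteq> \<zero>"
  shows "\<exists>u. P u \<and> u \<noteq> \<zero> \<and> A u = \<zero> \<and> B u = \<zero>"
proof (rule ccontr)
  assume "\<not> ?thesis"
  then have N: "x = \<zero>" if "P x" "A x = \<zero>" "B x = \<zero>" for x using that by blast
  have PT: "P (A x)" "P (B x)" "x \<in> carrier V" if "P x" for x using P that by auto
  have U0: "B (A (B (A x))) = \<ominus> A (B (A (B x)))" if "P x" for x
    by (rule minus_equality[symmetric]) (simp_all add: anti[OF that] PT that)
  have Pv: "P (A v)" "P (B v)" "P (A (B v))" "P (B (A v))" "P (A (B (A v)))" "P (B (A (B v)))" "P (A (B (A (B v))))"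
    by (intro PT v(1))+
  have "B (A (B (A (B v)))) = \<ominus> A (B (A (B (B v))))" by (rule U0[OF Pv(2)])
  then have "B (A (B (A (B v)))) = \<zero>" by (simp add: AA(2)[OF v(1)] zero)
  then have 1: "A (B (A (B v))) = \<zero>" by (intro N[OF Pv(7)] AA(1)[OF Pv(6)])
  then have 2: "B (A (B (A v))) = \<zero>" using U0[OF v(1)] by simp
  have "B (A (B v)) = \<zero>" by (rule N[OF Pv(6) 1 AA(2)[OF Pv(3)]])
  then have "A (B v) = \<zero>" by (rule N[OF Pv(3) AA(1)[OF Pv(2)]])
  then have B: "B v = \<zero>" by (rule N[OF Pv(2) _ AA(2)[OF v(1)]])
  have "A (B (A v)) = \<zero>" by (rule N[OF Pv(5) AA(1)[OF Pv(4)] 2])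
  then have "B (A v) = \<zero>" by (rule N[OF Pv(4) _ AA(2)[OF Pv(1)]])
  then have "A v = \<zero>" by (rule N[OF Pv(1) AA(1)[OF v(1)]])
  then show False using N[OF v(1) _ B] v(2) by blast
qed

text \<open>Put U = a1 a2 a1 a2. Then T + U acts by \<open>alpha3\<close>, and in T U the inner
  squares collapse one after another to \<open>alpha1^2 * alpha2^2\<close>. Applying T to the first
  fact gives the claim.\<close>

lemma a2121_quadratic:
  assumes "oftype \<chi> w"
  defines "T \<equiv> \<lambda>x. a2 (a1 (a2 (a1 x)))"
  shows "T (T w) \<oplus> (alpha1 l \<chi> ^ 2 * alpha2 l \<chi> ^ 2) *\<^sub>V w = alpha3 l \<chi> *\<^sub>V T w"
proof -
  have w [simp]: "w \<in> carrier V" using assms of_type_closed by blast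
  note t = of_type_a2[OF assms(1)] of_type_a1[OF of_type_a2[OF assms(1)]]
    of_type_a2[OF of_type_a1[OF of_type_a2[OF assms(1)]]]
  let ?U = "a1 (a2 (a1 (a2 w)))"
  have "T (?U \<oplus> T w) = alpha3 l \<chi> *\<^sub>V T w"
    using a1212_a2121[OF assms(1)] by (simp add: T_def)
  moreover have "T ?U = (alpha1 l \<chi> ^ 2 * alpha2 l \<chi> ^ 2) *\<^sub>V w"
    using a1_a1[OF t(3)] a2_a2[OF t(2)] a1_a1[OF t(1)] a2_a2[OF assms(1)]
    by (simp add: T_def power2_eq_square mult_ac)
  moreover have "T (?U \<oplus> T w) = T ?U \<oplus> T (T w)" by (simp add: T_def app_add_right)
  ultimately show ?thesis by (simp add: a_comm T_def)
qed

text \<open>The quadratic factors as (T - t1)(T - t2) = 0: either \<open>w\<close> is an eigenvector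
  for \<open>t2\<close>, or (T - t2) w is one for \<open>t1\<close>. Both have type \<chi>.\<close>

lemma a2121_eigenvector:
  assumes w: "oftype \<chi> w" "w \<noteq> \<zero>"
    and t: "t1 + t2 = alpha3 l \<chi>" "t1 * t2 = alpha1 l \<chi> ^ 2 * alpha2 l \<chi> ^ 2"
  obtains v where "oftype \<chi> v" "v \<noteq> \<zero>"
    "a2 (a1 (a2 (a1 v))) = t1 *\<^sub>V v \<or> a2 (a1 (a2 (a1 v))) = t2 *\<^sub>V v"
proof -
  define T where "T = (\<lambda>x. a2 (a1 (a2 (a1 x))))"
  have wc [simp]: "w \<in> carrier V" using w of_type_closed by blast
  have Tc [simp]: "T x \<in> carrier V" if "x \<in> carrier V" for x using that by (simp add: T_def)
  have tT: "oftype \<chi> (T w)"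
    using of_type_a2[OF of_type_a1[OF of_type_a2[OF of_type_a1[OF w(1)]]]] by (simp add: T_def)
  define x where "x = T w \<oplus> (- t2) *\<^sub>V w"
  show ?thesis
  proof (cases "x = \<zero>")
    case True
    then have "T w = t2 *\<^sub>V w"
      by (simp add: x_def scale_uminus) (metis Tc a_inv_closed add.inv_inv app_closed minus_equality wc)
    then show ?thesis using that w by (auto simp: T_def)
  next
    case False
    have "T (T w) \<oplus> (t1 * t2) *\<^sub>V w = (t1 + t2) *\<^sub>V T w"
      using a2121_quadratic[OF w(1)] t by (simp add: T_def)
    also have "\<dots> = t1 *\<^sub>V T w \<oplus> t2 *\<^sub>V T w" by (rule scale_add) simp
    finally have "(T (T w) \<oplus> (t1 * t2) *\<^sub>V w) \<oplus> ((- t2) *\<^sub>V T w \<oplus> (- (t1 * t2)) *\<^sub>V w)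
        = (t1 *\<^sub>V T w \<oplus> t2 *\<^sub>V T w) \<oplus> ((- t2) *\<^sub>V T w \<oplus> (- (t1 * t2)) *\<^sub>V w)" by simp
    moreover have "(T (T w) \<oplus> (t1 * t2) *\<^sub>V w) \<oplus> ((- t2) *\<^sub>V T w \<oplus> (- (t1 * t2)) *\<^sub>V w)
       = T (T w) \<oplus> (- t2) *\<^sub>V T w"
      by (simp add: scale_uminus a_ac r_neg2 r_neg1 r_neg l_neg)
    moreover have "(t1 *\<^sub>V T w \<oplus> t2 *\<^sub>V T w) \<oplus> ((- t2) *\<^sub>V T w \<oplus> (- (t1 * t2)) *\<^sub>V w)
       = t1 *\<^sub>V T w \<oplus> (- (t1 * t2)) *\<^sub>V w"
      by (simp add: scale_uminus a_ac r_neg2 r_neg1 r_neg l_neg)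
    moreover have "T x = T (T w) \<oplus> (- t2) *\<^sub>V T w"
      unfolding x_def by (simp add: T_def app_add_right)
    moreover have "t1 *\<^sub>V x = t1 *\<^sub>V T w \<oplus> (- (t1 * t2)) *\<^sub>V w"
      unfolding x_def by (simp add: app_add_right)
    ultimately have "T x = t1 *\<^sub>V x" by simp
    moreover have "oftype \<chi> x" unfolding x_def using w tT of_type_add of_type_scale by blast
    ultimately show ?thesis using that[of x] False by (auto simp: T_def)
  qed
qed

end

lemma mem_reps_iff:
  "L1 \<chi> \<in> reps N M l \<longleftrightarrow> \<chi> \<in> O1 N M l"
  "L2h \<chi> \<in> reps N M l \<longleftrightarrow> \<chi> \<in> O2 N M l \<and> alpha1 l \<chi> \<noteq> 0 \<and> pos (fst \<chi>)"
  "L2v \<chi> \<in> reps N M l \<longleftrightarrow> \<chi> \<in> O2 N M l \<and> alpha2 l \<chi> \<noteq> 0 \<and> pos (fst \<chi>)"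
  "L4 \<chi> d \<in> reps N M l \<longleftrightarrow> \<chi> \<in> O4 N M l \<and> normalized l (L4 \<chi> d) \<and>
     alpha1 l \<chi> ^ 2 * alpha2 l \<chi> * d ^ 2 - alpha3 l \<chi> * d + alpha2 l \<chi> = 0"
  by (auto simp: reps_def mem_labels_iff)

section \<open>Every simple module occurs in the list\<close>

context H_module_closed_field
begin

context
  assumes NM: "N \<ge> 1" "M \<ge> 1" and simple: "simple_module (H_alg N M l) V"
begin

lemma classify_O1:
  assumes "\<chi> \<in> O1 N M l" "oftype \<chi> v" "v \<noteq> \<zero>"
  shows "\<exists>x\<in>reps N M l. module_iso (H_alg N M l) V (label_module l x)"
proof -
  \<comment> \<open>The type is left open because \<open>a1\<close> and \<open>a2\<close> change it;
    they stay within \<open>O1\<close>, where all alphas vanish.\<close>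
  define P where "P = (\<lambda>x. \<exists>\<chi>\<in>O1 N M l. oftype \<chi> x)"
  have alpha: "alpha1 l \<chi> = 0" "alpha2 l \<chi> = 0" "alpha3 l \<chi> = 0" if "\<chi> \<in> O1 N M l" for \<chi>
    using that by (auto simp: O1_def)
  have "\<exists>u. P u \<and> u \<noteq> \<zero> \<and> a1 u = \<zero> \<and> a2 u = \<zero>"
  proof (rule common_kernel_vector)
    fix x assume "P x"
    then obtain \<chi> where c: "\<chi> \<in> O1 N M l" "oftype \<chi> x" unfolding P_def by blast
    have xc: "x \<in> carrier V" using of_type_closed[OF c(2)] .
    show "x \<in> carrier V \<and> P (a1 x) \<and> P (a2 x)"
      using c(1) of_type_a1[OF c(2)] of_type_a2[OF c(2)] xc O_sign(3,4) unfolding P_def by blast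
    show "a1 (a1 x) = \<zero>" "a2 (a2 x) = \<zero>" using a1_a1[OF c(2)] a2_a2[OF c(2)] alpha[OF c(1)] xc by auto
    show "a2 (a1 (a2 (a1 x))) \<oplus> a1 (a2 (a1 (a2 x))) = \<zero>"
      using a1212_a2121[OF c(2)] alpha[OF c(1)] xc by (simp add: a_comm)
  qed (use assms in \<open>auto simp: P_def\<close>)
  then obtain u \<chi>' where "\<chi>' \<in> O1 N M l" "oftype \<chi>' u" "u \<noteq> \<zero>" "a1 u = \<zero>" "a2 u = \<zero>"
    unfolding P_def by blast
  then show ?thesis using iso_L1[OF NM simple] mem_reps_iff(1) by blast
qed

text \<open>Here \<open>a2\<close> squares to zero, \<open>alpha3\<close> vanishes, and
  \<open>a1\<close> has trivial kernel on these types because its square is a nonzero scalar; so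
  \<open>nilpotent_vector\<close> applies with \<open>A = a2\<close> and
  \<open>B = a1\<close>.\<close>

lemma classify_O2h:
  assumes "\<chi> \<in> O2 N M l" "alpha1 l \<chi> \<noteq> 0" "oftype \<chi> v" "v \<noteq> \<zero>"
  shows "\<exists>x\<in>reps N M l. module_iso (H_alg N M l) V (label_module l x)"
proof -
  define P where "P = (\<lambda>x. \<exists>\<chi>\<in>O2 N M l. alpha1 l \<chi> \<noteq> 0 \<and> oftype \<chi> x)"
  have alpha: "alpha2 l \<chi> = 0" "alpha3 l \<chi> = 0" if "\<chi> \<in> O2 N M l" "alpha1 l \<chi> \<noteq> 0" for \<chi>
    using that by (auto simp: O2_def)
  obtain u where u: "P u" "u \<noteq> \<zero>" "a2 u = \<zero>" "a2 (a1 u) = \<zero>"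
  proof (rule nilpotent_vector)
    fix x assume "P x"
    then obtain \<chi> where c: "\<chi> \<in> O2 N M l" "alpha1 l \<chi> \<noteq> 0" "oftype \<chi> x" unfolding P_def by blast
    have xc: "x \<in> carrier V" using of_type_closed[OF c(3)] .
    show "x \<in> carrier V \<and> P (a2 x) \<and> P (a1 x)"
      using c(1,2) of_type_a1[OF c(3)] of_type_a2[OF c(3)] xc O_sign(5,6) alpha_bar(1) alpha_neg(1)
      unfolding P_def by metis
    show "a2 (a2 x) = \<zero>" using a2_a2[OF c(3)] alpha[OF c(1,2)] xc by auto
    show "x = \<zero>" if "a1 x = \<zero>"
      using a1_a1[OF c(3)] c(2) xc scale_eq_zero[OF xc, of "alpha1 l \<chi>"] that by auto
    show "a1 (a2 (a1 (a2 x))) \<oplus> a2 (a1 (a2 (a1 x))) = \<zero>"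
      using a1212_a2121[OF c(3)] alpha[OF c(1,2)] xc by simp
  qed (use assms in \<open>auto simp: P_def\<close>)
  then obtain \<chi>' where c: "\<chi>' \<in> O2 N M l" "alpha1 l \<chi>' \<noteq> 0" "oftype \<chi>' u" unfolding P_def by blast
  have uc: "u \<in> carrier V" using of_type_closed[OF c(3)] .
  show ?thesis
  proof (cases "pos (fst \<chi>')")
    case True
    then show ?thesis using c u iso_L2h[OF NM simple c] mem_reps_iff(2) by blast
  next
    case False
    \<comment> \<open>The vector \<open>a1 u\<close> satisfies the same kernel conditions and has
      the opposite first coordinate, so it yields the normalized label.\<close>
    have "fst \<chi>' \<noteq> 0" using chars_nonzero(1)[OF _ NM, of \<chi>'] c(1) by (auto simp: O2_def)
    then have "pos (fst (bar_char \<chi>'))" using False pos_uminus by auto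
    moreover have "a1 u \<noteq> \<zero>" using a1_a1[OF c(3)] c(2) uc scale_eq_zero[OF uc, of "alpha1 l \<chi>'"] u(2) by auto
    moreover have "a2 (a1 (a1 u)) = \<zero>" using a1_a1[OF c(3)] u(3) uc by simp
    ultimately show ?thesis
      using c u of_type_a1[OF c(3)] iso_L2h[OF NM simple, of "bar_char \<chi>'" "a1 u"]
      by (intro bexI[of _ "L2h (bar_char \<chi>')"]) (auto simp: mem_reps_iff)
  qed
qed

lemma classify_O2v:
  assumes "\<chi> \<in> O2 N M l" "alpha2 l \<chi> \<noteq> 0" "oftype \<chi> v" "v \<noteq> \<zero>"
  shows "\<exists>x\<in>reps N M l. module_iso (H_alg N M l) V (label_module l x)"
proof -
  define P where "P = (\<lambda>x. \<exists>\<chi>\<in>O2 N M l. alpha2 l \<chi> \<noteq> 0 \<and> oftype \<chi> x)"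
  have alpha: "alpha1 l \<chi> = 0" "alpha3 l \<chi> = 0" if "\<chi> \<in> O2 N M l" "alpha2 l \<chi> \<noteq> 0" for \<chi>
    using that by (auto simp: O2_def)
  obtain u where u: "P u" "u \<noteq> \<zero>" "a1 u = \<zero>" "a1 (a2 u) = \<zero>"
  proof (rule nilpotent_vector)
    fix x assume "P x"
    then obtain \<chi> where c: "\<chi> \<in> O2 N M l" "alpha2 l \<chi> \<noteq> 0" "oftype \<chi> x" unfolding P_def by blast
    have xc: "x \<in> carrier V" using of_type_closed[OF c(3)] .
    show "x \<in> carrier V \<and> P (a1 x) \<and> P (a2 x)"
      using c(1,2) of_type_a1[OF c(3)] of_type_a2[OF c(3)] xc O_sign(5,6) alpha_bar(2) alpha_neg(2)
      unfolding P_def by metis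
    show "a1 (a1 x) = \<zero>" using a1_a1[OF c(3)] alpha[OF c(1,2)] xc by auto
    show "x = \<zero>" if "a2 x = \<zero>"
      using a2_a2[OF c(3)] c(2) xc scale_eq_zero[OF xc, of "alpha2 l \<chi>"] that by auto
    show "a2 (a1 (a2 (a1 x))) \<oplus> a1 (a2 (a1 (a2 x))) = \<zero>"
      using a1212_a2121[OF c(3)] alpha[OF c(1,2)] xc by (simp add: a_comm)
  qed (use assms in \<open>auto simp: P_def\<close>)
  then obtain \<chi>' where c: "\<chi>' \<in> O2 N M l" "alpha2 l \<chi>' \<noteq> 0" "oftype \<chi>' u" unfolding P_def by blast
  have uc: "u \<in> carrier V" using of_type_closed[OF c(3)] .
  show ?thesis
  proof (cases "pos (fst \<chi>')")
    case True
    then show ?thesis using c u iso_L2v[OF NM simple c] mem_reps_iff(3) by blast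
  next
    case False
    have "fst \<chi>' \<noteq> 0" using chars_nonzero(1)[OF _ NM, of \<chi>'] c(1) by (auto simp: O2_def)
    then have "pos (fst (neg_char \<chi>'))" using False pos_uminus by auto
    moreover have "a2 u \<noteq> \<zero>" using a2_a2[OF c(3)] c(2) uc scale_eq_zero[OF uc, of "alpha2 l \<chi>'"] u(2) by auto
    moreover have "a1 (a2 (a2 u)) = \<zero>" using a2_a2[OF c(3)] u(3) uc by simp
    ultimately show ?thesis
      using c u of_type_a2[OF c(3)] iso_L2v[OF NM simple, of "neg_char \<chi>'" "a2 u"]
      by (intro bexI[of _ "L2v (neg_char \<chi>')"]) (auto simp: mem_reps_iff)
  qed
qed

text \<open>The squares of \<open>a1\<close> and \<open>a2\<close> are nonzero scalars, so these
  operators carry nonzero vectors to nonzero vectors and all four sign changes of \<chi> occur. The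
  type can thus be normalized before an eigenvector is chosen.\<close>

lemma classify_O4_nondegenerate:
  assumes chi: "\<chi> \<in> O4 N M l" and alpha: "alpha1 l \<chi> * alpha2 l \<chi> \<noteq> 0" and v: "oftype \<chi> v" "v \<noteq> \<zero>"
  shows "\<exists>x\<in>reps N M l. module_iso (H_alg N M l) V (label_module l x)"
proof -
  define P where "P = (\<lambda>\<chi>. \<chi> \<in> O4 N M l \<and> alpha1 l \<chi> * alpha2 l \<chi> \<noteq> 0 \<and> (\<exists>w. oftype \<chi> w \<and> w \<noteq> \<zero>))"
  have P_bar: "P (bar_char \<chi>)" and P_neg: "P (neg_char \<chi>)" if P: "P \<chi>" for \<chi>
  proof -
    obtain w where w: "oftype \<chi> w" "w \<noteq> \<zero>" using P unfolding P_def by blast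
    have wc: "w \<in> carrier V" using of_type_closed[OF w(1)] .
    have al: "alpha1 l \<chi> \<noteq> 0" "alpha2 l \<chi> \<noteq> 0" using P by (auto simp: P_def)
    have "a1 w \<noteq> \<zero>" "a2 w \<noteq> \<zero>"
      using a1_a1[OF w(1)] a2_a2[OF w(1)] al w(2) scale_eq_zero[OF wc] by (metis app_zero_right)+
    then show "P (bar_char \<chi>)" "P (neg_char \<chi>)"
      using P of_type_a1[OF w(1)] of_type_a2[OF w(1)] unfolding P_def alpha_bar alpha_neg O_sign by blast+
  qed
  have nz: "fst \<chi> \<noteq> 0" "snd \<chi> \<noteq> 0" if "P \<chi>" for \<chi>
    using chars_nonzero[OF _ NM, of \<chi>] that by (auto simp: O4_def P_def)
  have "P \<chi>" using assms by (auto simp: P_def)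
  then obtain \<chi>1 where 1: "P \<chi>1" "pos (snd \<chi>1)"
    using P_neg[of \<chi>] pos_uminus[OF nz(2)[of \<chi>]] by (cases "pos (snd \<chi>)") auto
  then obtain \<chi>' where 2: "P \<chi>'" "pos (snd \<chi>')" "pos (fst \<chi>')"
    using P_bar[of \<chi>1] pos_uminus[OF nz(1)[of \<chi>1]] by (cases "pos (fst \<chi>1)") auto
  then obtain w where w: "oftype \<chi>' w" "w \<noteq> \<zero>" unfolding P_def by blast
  \<comment> \<open>The quadratic satisfied by T. Its roots have the nonzero product
    \<open>alpha1^2 * alpha2^2\<close>, so either eigenvalue is admissible in
    \<open>iso_L4\<close>.\<close>
  let ?p = "[: alpha1 l \<chi>' ^ 2 * alpha2 l \<chi>' ^ 2, - alpha3 l \<chi>', 1 :]"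
  obtain t1 where "poly ?p t1 = 0" using alg_closed_imp_poly_has_root[of ?p] by auto
  then have t1: "t1 * (alpha3 l \<chi>' - t1) = alpha1 l \<chi>' ^ 2 * alpha2 l \<chi>' ^ 2"
    by (simp add: algebra_simps)
  obtain u where u: "oftype \<chi>' u" "u \<noteq> \<zero>"
      "a2 (a1 (a2 (a1 u))) = t1 *\<^sub>V u \<or> a2 (a1 (a2 (a1 u))) = (alpha3 l \<chi>' - t1) *\<^sub>V u"
    by (rule a2121_eigenvector[OF w, of t1 "alpha3 l \<chi>' - t1"]) (use t1 in auto)
  have "t1 \<noteq> 0" "alpha3 l \<chi>' - t1 \<noteq> 0" using t1 2(1) by (auto simp: P_def)
  then obtain t where t: "t \<noteq> 0" "a2 (a1 (a2 (a1 u))) = t *\<^sub>V u" using u(3) by metis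
  have O4: "\<chi>' \<in> O4 N M l" using 2 by (simp add: P_def)
  show ?thesis using iso_L4[OF NM simple O4 u(1,2) t(2,1)] 2
    by (intro bexI[of _ "L4 \<chi>' (alpha2 l \<chi>' / t)"]) (auto simp: reps_def)
qed

text \<open>The quadratic of T has the roots \<open>alpha3\<close> and 0, with
  \<open>alpha3 \<noteq> 0\<close> in \<open>O4\<close>. The eigenvalue \<open>alpha3\<close> has to
  be secured before the type is normalized, and only moves that preserve it are then
  allowed.\<close>

lemma classify_O4_degenerate:
  assumes chi: "\<chi> \<in> O4 N M l" and alpha: "alpha1 l \<chi> * alpha2 l \<chi> = 0" and v: "oftype \<chi> v" "v \<noteq> \<zero>"
  shows "\<exists>x\<in>reps N M l. module_iso (H_alg N M l) V (label_module l x)"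
proof -
  define t where "t = alpha3 l \<chi>"
  have t: "t \<noteq> 0" using chi alpha by (auto simp: O4_def O1_def O2_def t_def)
  define P where "P = (\<lambda>\<chi> w. \<chi> \<in> O4 N M l \<and> alpha1 l \<chi> * alpha2 l \<chi> = 0 \<and> oftype \<chi> w \<and> w \<noteq> \<zero>
     \<and> a2 (a1 (a2 (a1 w))) = t *\<^sub>V w)"
  have "\<exists>\<chi>' w. P \<chi>' w"
  proof -
    obtain w where w: "oftype \<chi> w" "w \<noteq> \<zero>"
        "a2 (a1 (a2 (a1 w))) = t *\<^sub>V w \<or> a2 (a1 (a2 (a1 w))) = 0 *\<^sub>V w"
      by (rule a2121_eigenvector[OF v, of t 0]) (use alpha in \<open>auto simp: t_def\<close>)
    have wc: "w \<in> carrier V" using of_type_closed[OF w(1)] .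
    show ?thesis
    proof (cases "a2 (a1 (a2 (a1 w))) = t *\<^sub>V w")
      case True
      then show ?thesis using w chi alpha unfolding P_def by blast
    next
      case False
      \<comment> \<open>If T kills \<open>w\<close>, the other summand of the quartic relation acts
        on \<open>w\<close> by \<open>t\<close>, and shifting the bracket shows that
        \<open>a2 w\<close> is an eigenvector of T for \<open>t\<close>.\<close>
      then have "a1 (a2 (a1 (a2 w))) = t *\<^sub>V w"
        using a1212_a2121[OF w(1)] w(3) wc by (simp add: t_def)
      moreover from this have "a2 w \<noteq> \<zero>" using scale_eq_zero[OF wc, of t] t w(2) by auto
      ultimately have "P (neg_char \<chi>) (a2 w)"
        using of_type_a2[OF w(1)] chi alpha wc by (simp add: P_def)
      then show ?thesis by blast
    qed
  qed
  then obtain \<chi>1 w where 1: "P \<chi>1 w" by blast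
  have wc: "w \<in> carrier V" using of_type_closed[of \<chi>1] 1 by (auto simp: P_def)
  have nz: "snd \<chi>1 \<noteq> 0" using chars_nonzero[OF _ NM, of \<chi>1] 1 by (auto simp: O4_def P_def)
  have "\<exists>\<chi>' w. P \<chi>' w \<and> pos (snd \<chi>')"
  proof (cases "pos (snd \<chi>1)")
    case False
    \<comment> \<open>The product a2 a1 commutes with T, which is its square, and changes the sign
      of the second coordinate only.\<close>
    have "a2 (a1 w) \<noteq> \<zero>" using scale_eq_zero[OF wc, of t] t 1 by (auto simp: P_def)
    then have "P (neg_char (bar_char \<chi>1)) (a2 (a1 w))"
      using 1 of_type_a2[OF of_type_a1[of \<chi>1 w]] wc by (simp add: P_def)
    moreover have "pos (snd (neg_char (bar_char \<chi>1)))" using False pos_uminus[OF nz] by simp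
    ultimately show ?thesis by blast
  qed (use 1 in blast)
  then obtain \<chi>' u where 2: "P \<chi>' u" "pos (snd \<chi>')" by blast
  have O4: "\<chi>' \<in> O4 N M l" "oftype \<chi>' u" "u \<noteq> \<zero>" "a2 (a1 (a2 (a1 u))) = t *\<^sub>V u"
    "alpha1 l \<chi>' * alpha2 l \<chi>' = 0" using 2 by (simp_all add: P_def)
  show ?thesis using iso_L4[OF NM simple O4(1-4) t] 2 O4(5)
    by (intro bexI[of _ "L4 \<chi>' (alpha2 l \<chi>' / t)"]) (auto simp: reps_def)
qed

lemma classification: "\<exists>x\<in>reps N M l. module_iso (H_alg N M l) V (label_module l x)"
proof -
  have "carrier V \<noteq> {\<zero>}" using simple unfolding simple_iff by blast
  then obtain \<chi> v where v: "\<chi> \<in> chars N M" "oftype \<chi> v" "v \<noteq> \<zero>"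
    using exists_typed_vector[OF NM] by blast
  consider "\<chi> \<in> O1 N M l" | "\<chi> \<in> O2 N M l" "alpha1 l \<chi> \<noteq> 0" | "\<chi> \<in> O2 N M l" "alpha2 l \<chi> \<noteq> 0"
    | "\<chi> \<in> O4 N M l" "alpha1 l \<chi> * alpha2 l \<chi> \<noteq> 0" | "\<chi> \<in> O4 N M l" "alpha1 l \<chi> * alpha2 l \<chi> = 0"
    using v(1) by (auto simp: O1_def O2_def O4_def)
  then show ?thesis
    by cases (use v classify_O1 classify_O2h classify_O2v classify_O4_nondegenerate
        classify_O4_degenerate in blast)+
qed

end

end

text \<open>An isomorphism sends the first basis vector of \<open>x\<close> to a vector with the
  same type and eigenvalue, so this pair occurs at some index \<open>j\<close> of \<open>y\<close>.
  The alphas then agree, hence so does the kind of label, and normalization restricts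
  \<open>j\<close>.\<close>

lemma reps_pairwise_noniso:
  fixes l :: "'k::{alg_closed_field, field_char_0} \<times> 'k \<times> 'k"
  assumes NM: "N \<ge> 1" "M \<ge> 1" and x: "x \<in> reps N M l" and y: "y \<in> reps N M l"
    and iso: "module_iso (H_alg N M l) (label_module l x) (label_module l y)"
  shows "x = y"
proof -
  have xl: "x \<in> labels N M l" "normalized l x" and yl: "y \<in> labels N M l" "normalized l y"
    using x y by (auto simp: reps_def)
  have sub: "(\<lambda>j. (basis_types x ! j, eigenvalue l x j)) ` {..<dim x}
      \<subseteq> (\<lambda>j. (basis_types y ! j, eigenvalue l y j)) ` {..<dim y}"
    using spectrum_iso[OF iso] label_module_H_module[OF xl(1)] label_module_H_module[OF yl(1)]
    by (simp only: spectrum_label_module[OF xl(1)] spectrum_label_module[OF yl(1)])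
  define \<chi> where "\<chi> = label_char x"
  define \<psi> where "\<psi> = label_char y"
  have "0 < dim x" "basis_types x ! 0 = \<chi>" by (cases x; simp add: \<chi>_def)+
  then have "(\<chi>, eigenvalue l x 0) \<in> (\<lambda>j. (basis_types y ! j, eigenvalue l y j)) ` {..<dim y}"
    using sub by force
  then obtain j where j: "j < dim y" "\<chi> = basis_types y ! j" "eigenvalue l x 0 = eigenvalue l y j"
    by auto
  have al: "alpha1 l \<chi> = alpha1 l \<psi>" "alpha2 l \<chi> = alpha2 l \<psi>" "alpha3 l \<chi> = alpha3 l \<psi>"
    using j by (simp_all add: \<psi>_def)
  have ch: "\<chi> \<in> chars N M" "\<psi> \<in> chars N M"
    unfolding \<chi>_def \<psi>_def using label_char_chars xl yl by blast+
  have nz: "fst \<psi> \<noteq> 0" "snd \<psi> \<noteq> 0" using chars_nonzero[OF ch(2) NM] .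
  note pm = pos_uminus[OF nz(1)] pos_uminus[OF nz(2)]
  have Oc: "\<chi> \<in> O1 N M l \<longleftrightarrow> \<psi> \<in> O1 N M l" "\<chi> \<in> O2 N M l \<longleftrightarrow> \<psi> \<in> O2 N M l" "\<chi> \<in> O4 N M l \<longleftrightarrow> \<psi> \<in> O4 N M l"
    using al ch by (auto simp: O1_def O2_def O4_def)
  have disj: "\<not> (\<psi> \<in> O1 N M l \<and> \<psi> \<in> O2 N M l)" "\<not> (\<psi> \<in> O1 N M l \<and> \<psi> \<in> O4 N M l)" "\<not> (\<psi> \<in> O2 N M l \<and> \<psi> \<in> O4 N M l)"
    "\<psi> \<in> O2 N M l \<Longrightarrow> alpha1 l \<psi> = 0 \<or> alpha2 l \<psi> = 0"
    by (auto simp: O1_def O2_def O4_def)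
  show ?thesis
  proof (cases y)
    case (L1 \<psi>')
    then show ?thesis using xl yl Oc disj j by (cases x) (auto simp: \<chi>_def \<psi>_def mem_labels_iff)
  next
    case (L2h \<psi>')
    then show ?thesis using xl yl Oc disj j al pm
      by (cases x) (auto simp: \<chi>_def \<psi>_def mem_labels_iff less_Suc_eq)
  next
    case (L2v \<psi>')
    then show ?thesis using xl yl Oc disj j al pm
      by (cases x) (auto simp: \<chi>_def \<psi>_def mem_labels_iff less_Suc_eq)
  next
    case y: (L4 \<psi>' d')
    then have [simp]: "\<psi>' = \<psi>" by (simp add: \<psi>_def)
    have "\<psi> \<in> O4 N M l" using yl y by (simp add: mem_labels_iff)
    then obtain d where x: "x = L4 \<chi> d" using xl Oc disj by (cases x) (auto simp: \<chi>_def mem_labels_iff)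
    have ev: "c_of l \<chi> d = eigenvalue l y j" using j(3) x by simp
    show ?thesis
    proof (cases "alpha1 l \<psi> * alpha2 l \<psi> = 0")
      case False
      then have "pos (fst \<psi>)" "pos (snd \<psi>)" "pos (fst \<chi>)" "pos (snd \<chi>)"
        using xl yl x y al by auto
      \<comment> \<open>Any other index would flip the sign of a coordinate. Since
        \<open>alpha1^2 * alpha2 \<noteq> 0\<close>, the common eigenvalue \<open>c\<close> then
        determines \<open>d\<close>.\<close>
      then have j0: "j = 0" using j(1,2) pm y by (auto simp: less_Suc_eq numeral_eq_Suc)
      then have "\<chi> = \<psi>" using j y by simp
      then show ?thesis using ev False unfolding x y j0 by (simp add: c_of_def)
    next
      case True
      then have p: "pos (snd \<psi>)" "pos (snd \<chi>)"
        using xl yl x y al by auto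
      have a3: "alpha3 l \<psi> \<noteq> 0" using True \<open>\<psi> \<in> O4 N M l\<close> by (auto simp: O1_def O2_def O4_def)
      have a0: "alpha1 l \<psi> ^ 2 * alpha2 l \<psi> = 0" using True by auto
      have "j = 0 \<or> j = 1" using j(1,2) p pm y by (auto simp: less_Suc_eq numeral_eq_Suc)
      \<comment> \<open>Here \<open>c\<close> equals \<open>alpha3\<close>, which is nonzero, while
        the eigenvalue of \<open>y\<close> at index 1 is \<open>alpha3 - c = 0\<close>.\<close>
      moreover have "j \<noteq> 1" using ev a0 a3 y by (auto simp: c_of_def al)
      ultimately have "\<chi> = \<psi>" using j y by simp
      \<comment> \<open>The equation for \<open>d\<close> is now linear with leading coefficient
        \<open>- alpha3\<close>.\<close>
      moreover have "d = d'" using xl(1) yl(1) a0 a3 al unfolding x y by (auto simp: mem_labels_iff)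
      ultimately show ?thesis by (simp add: x y)
    qed
  qed
qed

section \<open>Counting\<close>

lemma card_involution:
  assumes "finite S" "\<And>x. x \<in> S \<Longrightarrow> f x \<in> S" "\<And>x. x \<in> S \<Longrightarrow> f (f x) = x"
    and "\<And>x. x \<in> S \<Longrightarrow> P (f x) \<longleftrightarrow> \<not> P x"
  shows "2 * card {x \<in> S. P x} = card S"
proof -
  have "bij_betw f {x \<in> S. P x} {x \<in> S. \<not> P x}"
    by (rule bij_betw_byWitness[where f' = f]) (use assms in auto)
  then have "card {x \<in> S. P x} = card {x \<in> S. \<not> P x}" by (rule bij_betw_same_card)
  moreover have "card S = card ({x \<in> S. P x} \<union> {x \<in> S. \<not> P x})" by (rule arg_cong[of _ _ card]) auto
  moreover have "\<dots> = card {x \<in> S. P x} + card {x \<in> S. \<not> P x}"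
    using assms(1) by (intro card_Un_disjoint) auto
  ultimately show ?thesis by simp
qed

lemma finite_chars:
  assumes "N \<ge> 1" "M \<ge> 1"
  shows "finite (chars N M :: ('k::field \<times> 'k) set)"
proof -
  have "finite {x :: 'k. x ^ n = 1}" if "n \<ge> 1" for n
  proof -
    have "Polynomial.monom (1 :: 'k) n \<noteq> 1"
      using that by (metis degree_1 degree_monom_eq not_one_le_zero one_neq_zero)
    then have "finite {x. poly (Polynomial.monom (1 :: 'k) n - 1) x = 0}" by (intro poly_roots_finite) simp
    then show ?thesis by (simp add: poly_monom)
  qed
  then show ?thesis using assms by (simp add: chars_def roots_of_1_def)
qed

text \<open>The polynomial splits into linear factors, whose roots form the multiset
  \<open>proots p\<close>; its size is the degree and its counts are the orders.\<close>

lemma sum_order_eq_degree: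
  fixes p :: "'k::alg_closed_field poly"
  assumes "p \<noteq> 0"
  shows "(\<Sum>x | poly p x = 0. Polynomial.order x p) = degree p"
proof -
  obtain A where A: "size A = degree p" "p = Polynomial.smult (lead_coeff p) (\<Prod>x\<in>#A. [:- x, 1:])"
    using alg_closed_imp_factorization[OF assms] by blast
  have "proots (\<Prod>x\<in>#A. [:- x, 1:]) = A" for A :: "'k multiset"
  proof (induction A)
    case (add x A)
    have "(\<Prod>x\<in>#A. [:- x, 1:]) \<noteq> 0" by (auto simp: prod_mset_zero_iff)
    then show ?case using add by (simp add: proots_mult del: mult_pCons_left)
  qed simp
  then have "proots p = A" using assms by (subst A(2)) simp
  then have "degree p = size (proots p)" using A(1) by simp
  also have "\<dots> = (\<Sum>x\<in>set_mset (proots p). count (proots p) x)" by (rule size_multiset_overloaded_eq)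
  finally show ?thesis using assms by simp
qed

context
  fixes N M :: nat and l :: "'k::{alg_closed_field, field_char_0} \<times> 'k \<times> 'k"
  assumes NM: "N \<ge> 1" "M \<ge> 1"
begin

lemma pos_chars:
  fixes \<chi> :: "'k \<times> 'k"
  assumes "\<chi> \<in> chars N M"
  shows "pos (- fst \<chi>) \<longleftrightarrow> \<not> pos (fst \<chi>)" "pos (- snd \<chi>) \<longleftrightarrow> \<not> pos (snd \<chi>)"
proof -
  show "pos (- fst \<chi>) \<longleftrightarrow> \<not> pos (fst \<chi>)" by (rule pos_uminus) (rule chars_nonzero[OF assms NM])
  show "pos (- snd \<chi>) \<longleftrightarrow> \<not> pos (snd \<chi>)" by (rule pos_uminus) (rule chars_nonzero[OF assms NM])
qed

lemma finite_O: "finite (O2 N M l)" "finite (O4 N M l)"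
  by (rule finite_subset[OF _ finite_chars[OF NM]]; auto simp: O2_def O4_def)+

text \<open>The two parts of \<open>O2\<close> are halved by the sign of the first coordinate. The
  involution \<open>bar_char\<close> serves for both, although isomorphic \<open>L2v\<close> modules
  pair \<chi> with its negative.\<close>

lemma card_reps_L2:
  "2 * (card {\<chi>. L2h \<chi> \<in> reps N M l} + card {\<chi>. L2v \<chi> \<in> reps N M l}) = card (O2 N M l)"
proof -
  let ?A = "{\<chi> \<in> O2 N M l. alpha1 l \<chi> \<noteq> 0}" and ?B = "{\<chi> \<in> O2 N M l. alpha2 l \<chi> \<noteq> 0}"
  have ch: "\<chi> \<in> chars N M" if "\<chi> \<in> O2 N M l" for \<chi> using that by (simp add: O2_def)
  have "2 * card {\<chi> \<in> ?A. pos (fst \<chi>)} = card ?A"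
    by (rule card_involution[of _ bar_char]) (use finite_O ch pos_chars in auto)
  moreover have "2 * card {\<chi> \<in> ?B. pos (fst \<chi>)} = card ?B"
    by (rule card_involution[of _ bar_char]) (use finite_O ch pos_chars in auto)
  moreover have "card (O2 N M l) = card (?A \<union> ?B)" by (rule arg_cong[of _ _ card]) (auto simp: O2_def)
  moreover have "card (?A \<union> ?B) = card ?A + card ?B"
  proof (rule card_Un_disjoint)
    show "?A \<inter> ?B = {}" by (auto simp: O2_def)
  qed (use finite_O in auto)
  ultimately show ?thesis by (simp add: mem_reps_iff conj_assoc)
qed

text \<open>Where \<open>alpha1 * alpha2 \<noteq> 0\<close>, normalization keeps a quarter of the
  characters and \<open>d_poly\<close> has degree 2; elsewhere it keeps half of them and
  \<open>d_poly\<close> has degree 1. Summing orders over the roots gives the degree, so both parts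
  contribute half of their cardinality.\<close>

lemma sum_reps_L4:
  "2 * (\<Sum>(\<chi>, d) \<in> {(\<chi>, d). L4 \<chi> d \<in> reps N M l}. Polynomial.order d (d_poly l \<chi>)) = card (O4 N M l)"
proof -
  let ?A = "{\<chi> \<in> O4 N M l. alpha1 l \<chi> * alpha2 l \<chi> \<noteq> 0}" and ?B = "{\<chi> \<in> O4 N M l. alpha1 l \<chi> * alpha2 l \<chi> = 0}"
  let ?QA = "{\<chi> \<in> {\<chi> \<in> ?A. pos (fst \<chi>)}. pos (snd \<chi>)}" and ?QB = "{\<chi> \<in> ?B. pos (snd \<chi>)}"
  have ch: "\<chi> \<in> chars N M" if "\<chi> \<in> O4 N M l" for \<chi> using that by (simp add: O4_def)
  note pc = pos_chars[OF ch]
  note fin = finite_O(2)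
  \<comment> \<open>This composite flips only the second coordinate and so preserves the condition
    already imposed on the first.\<close>
  have "2 * card ?QA = card {\<chi> \<in> ?A. pos (fst \<chi>)}"
    by (rule card_involution[of _ "\<lambda>\<chi>. neg_char (bar_char \<chi>)"]) (use fin in \<open>simp_all add: pc\<close>)
  moreover have "2 * card {\<chi> \<in> ?A. pos (fst \<chi>)} = card ?A"
    by (rule card_involution[of _ bar_char]) (use fin in \<open>simp_all add: pc\<close>)
  moreover have "2 * card ?QB = card ?B"
    by (rule card_involution[of _ neg_char]) (use fin in \<open>simp_all add: pc\<close>)
  moreover have "card (O4 N M l) = card (?A \<union> ?B)" by (rule arg_cong[of _ _ card]) auto
  moreover have "card (?A \<union> ?B) = card ?A + card ?B"
    using fin by (intro card_Un_disjoint) auto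
  ultimately have card: "card (O4 N M l) = 2 * (2 * card ?QA + card ?QB)" by simp
  have nz: "alpha2 l \<chi> \<noteq> 0 \<or> alpha3 l \<chi> \<noteq> 0" if "\<chi> \<in> O4 N M l" for \<chi>
    using that by (auto simp: O4_def O1_def O2_def)
  have p0: "d_poly l \<chi> \<noteq> 0" if "\<chi> \<in> O4 N M l" for \<chi>
    using nz[OF that] by (auto simp: d_poly_def)
  have a3: "alpha3 l \<chi> \<noteq> 0" if "\<chi> \<in> ?B" for \<chi> using that by (auto simp: O4_def O1_def O2_def)
  have deg2: "degree (d_poly l \<chi>) = 2" if "\<chi> \<in> ?A" for \<chi>
    using that by (auto simp: d_poly_def)
  have deg1: "degree (d_poly l \<chi>) = 1" if "\<chi> \<in> ?B" for \<chi>
    using that a3[OF that] by (auto simp: d_poly_def)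
  have "{(\<chi>, d). L4 \<chi> d \<in> reps N M l} = Sigma (?QA \<union> ?QB) (\<lambda>\<chi>. {d. poly (d_poly l \<chi>) d = 0})"
    by (auto simp: mem_reps_iff d_poly_def power2_eq_square algebra_simps)
  then have "(\<Sum>(\<chi>, d) \<in> {(\<chi>, d). L4 \<chi> d \<in> reps N M l}. Polynomial.order d (d_poly l \<chi>))
    = (\<Sum>(\<chi>, d) \<in> Sigma (?QA \<union> ?QB) (\<lambda>\<chi>. {d. poly (d_poly l \<chi>) d = 0}). Polynomial.order d (d_poly l \<chi>))"
    by simp
  also have "\<dots> = (\<Sum>\<chi> \<in> ?QA \<union> ?QB. \<Sum>d | poly (d_poly l \<chi>) d = 0. Polynomial.order d (d_poly l \<chi>))"
    using fin p0 by (intro sum.Sigma[symmetric]) (auto intro: poly_roots_finite)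
  also have "\<dots> = (\<Sum>\<chi> \<in> ?QA \<union> ?QB. degree (d_poly l \<chi>))"
    by (intro sum.cong sum_order_eq_degree p0) auto
  also have "\<dots> = (\<Sum>\<chi> \<in> ?QA. degree (d_poly l \<chi>)) + (\<Sum>\<chi> \<in> ?QB. degree (d_poly l \<chi>))"
    using fin by (intro sum.union_disjoint) auto
  also have "(\<Sum>\<chi> \<in> ?QA. degree (d_poly l \<chi>)) = (\<Sum>\<chi> \<in> ?QA. 2)" by (intro sum.cong deg2) auto
  also have "(\<Sum>\<chi> \<in> ?QB. degree (d_poly l \<chi>)) = (\<Sum>\<chi> \<in> ?QB. 1)" by (intro sum.cong deg1) auto
  finally show ?thesis using card by simp
qed

text \<open>The excluded equality is the vanishing of the discriminant
  \<open>alpha3^2 - 4 * alpha1^2 * alpha2^2\<close>. If \<open>alpha1 * alpha2 = 0\<close>, the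
  polynomial is linear with \<open>alpha3 \<noteq> 0\<close>, and its root is simple.\<close>

lemma order_d_poly_eq_1:
  assumes "\<chi> \<in> O4 N M l" "poly (d_poly l \<chi>) d = 0"
    and "alpha1 l \<chi> \<noteq> 0 \<and> alpha2 l \<chi> \<noteq> 0 \<longrightarrow> alpha3 l \<chi> ^ 2 \<noteq> 4 * alpha1 l \<chi> ^ 2 * alpha2 l \<chi> ^ 2"
  shows "Polynomial.order d (d_poly l \<chi>) = 1"
proof -
  let ?a = "alpha1 l \<chi> ^ 2 * alpha2 l \<chi>"
  have nz: "alpha1 l \<chi> * alpha2 l \<chi> = 0 \<Longrightarrow> alpha3 l \<chi> \<noteq> 0"
    using assms(1) by (auto simp: O4_def O1_def O2_def)
  have "rsquarefree (d_poly l \<chi>)"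
    unfolding rsquarefree_roots
  proof (intro allI notI)
    fix r assume r: "poly (d_poly l \<chi>) r = 0 \<and> poly (pderiv (d_poly l \<chi>)) r = 0"
    then have 1: "alpha2 l \<chi> + r * (?a * r - alpha3 l \<chi>) = 0" and 2: "alpha3 l \<chi> = 2 * ?a * r"
      by (simp_all add: d_poly_def pderiv_pCons algebra_simps)
    show False
    proof (cases "alpha1 l \<chi> * alpha2 l \<chi> = 0")
      case True then show False using 2 nz by auto
    next
      case False
      have "alpha3 l \<chi> ^ 2 = 4 * ?a * (?a * r ^ 2)" unfolding 2 by (simp add: power2_eq_square)
      also have "?a * r ^ 2 = alpha2 l \<chi>" using 1 unfolding 2 by (simp add: power2_eq_square algebra_simps)
      finally show False using assms(3) False by (simp add: power2_eq_square mult_ac)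
    qed
  qed
  then show ?thesis using assms(2) unfolding rsquarefree_def order_root by metis
qed

lemma card_reps_L4:
  assumes "\<forall>\<chi>\<in>O4 N M l. alpha1 l \<chi> \<noteq> 0 \<and> alpha2 l \<chi> \<noteq> 0 \<longrightarrow>
     alpha3 l \<chi> ^ 2 \<noteq> 4 * alpha1 l \<chi> ^ 2 * alpha2 l \<chi> ^ 2"
  shows "2 * card {(\<chi>, d). L4 \<chi> d \<in> reps N M l} = card (O4 N M l)"
proof -
  have "Polynomial.order d (d_poly l \<chi>) = 1" if "L4 \<chi> d \<in> reps N M l" for \<chi> d
    using that assms by (intro order_d_poly_eq_1)
      (auto simp: mem_reps_iff d_poly_def power2_eq_square algebra_simps)
  then have "(\<Sum>(\<chi>, d) \<in> {(\<chi>, d). L4 \<chi> d \<in> reps N M l}. Polynomial.order d (d_poly l \<chi>))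
     = (\<Sum>(\<chi>, d) \<in> {(\<chi>, d). L4 \<chi> d \<in> reps N M l}. 1)"
    by (intro sum.cong) auto
  then show ?thesis using sum_reps_L4 by (simp add: case_prod_beta)
qed

end

theorem mainTheorem1:
  fixes N M :: nat
    and l :: "'k::{alg_closed_field, field_char_0} \<times> 'k \<times> 'k"
  assumes "N \<ge> 1" and "M \<ge> 1"
  shows
    "chars N M = O1 N M l \<union> O2 N M l \<union> O4 N M l \<and>
     O1 N M l \<inter> O2 N M l = {} \<and> O1 N M l \<inter> O4 N M l = {} \<and> O2 N M l \<inter> O4 N M l = {} \<and>
     (\<exists>L :: 'k label \<Rightarrow> ('k, nat \<Rightarrow> 'k) H_mod.
        (\<forall>x\<in>labels N M l. has_form N M l x (L x) \<and> simple_module (H_alg N M l) (L x)) \<and>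
        (\<exists>R \<subseteq> labels N M l.
           (\<forall>x\<in>R. \<forall>y\<in>R. module_iso (H_alg N M l) (L x) (L y) \<longrightarrow> x = y) \<and>
           (\<forall>S :: ('k, 'v) H_mod. simple_module (H_alg N M l) S \<longrightarrow>
              (\<exists>x\<in>R. module_iso (H_alg N M l) S (L x))) \<and>
           card {\<chi>. L1 \<chi> \<in> R} = card (O1 N M l) \<and>
           2 * (card {\<chi>. L2h \<chi> \<in> R} + card {\<chi>. L2v \<chi> \<in> R}) = card (O2 N M l) \<and>
           2 * (\<Sum>(\<chi>, d) \<in> {(\<chi>, d). L4 \<chi> d \<in> R}. Polynomial.order d (d_poly l \<chi>))
             = card (O4 N M l) \<and>
           ((\<forall>\<chi>\<in>O4 N M l. alpha1 l \<chi> \<noteq> 0 \<and> alpha2 l \<chi> \<noteq> 0 \<longrightarrow>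
               (alpha3 l \<chi>) ^ 2 \<noteq> 4 * (alpha1 l \<chi>) ^ 2 * (alpha2 l \<chi>) ^ 2) \<longrightarrow>
            2 * card {(\<chi>, d). L4 \<chi> d \<in> R} = card (O4 N M l))))"
proof (intro conjI exI[of _ "label_module l"] exI[of _ "reps N M l"] ballI allI impI)
  show "chars N M = O1 N M l \<union> O2 N M l \<union> O4 N M l"
    "O1 N M l \<inter> O2 N M l = {}" "O1 N M l \<inter> O4 N M l = {}" "O2 N M l \<inter> O4 N M l = {}"
    by (auto simp: O1_def O2_def O4_def)
  show "reps N M l \<subseteq> labels N M l" by (auto simp: reps_def)
next
  fix x assume "x \<in> labels N M l"
  then show "has_form N M l x (label_module l x)" "simple_module (H_alg N M l) (label_module l x)"
    using has_form_label_module simple_label_module assms by blast+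
next
  fix x y assume "x \<in> reps N M l" "y \<in> reps N M l" "module_iso (H_alg N M l) (label_module l x) (label_module l y)"
  then show "x = y" by (rule reps_pairwise_noniso[OF assms])
next
  fix S :: "('k, 'v) H_mod" assume S: "simple_module (H_alg N M l) S"
  interpret H_module_closed_field N M l S
    using S unfolding H_module_closed_field_def H_module_def simple_module_def by blast
  show "\<exists>x\<in>reps N M l. module_iso (H_alg N M l) S (label_module l x)"
    by (rule classification[OF assms S])
next
  show "card {\<chi>. L1 \<chi> \<in> reps N M l} = card (O1 N M l)" by (simp add: mem_reps_iff)
qed (rule card_reps_L2[OF assms] sum_reps_L4[OF assms] card_reps_L4[OF assms]; assumption)+

end
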